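(* Let $n\leq 4$ be a positive integer and let $A\in M(n,\mathbb{C})$ be an $n\times n$ complex matrix. Then there exists a unitary matrix $U\in U(n)$ such that $UAU^{\ast}$ is tridiagonal.
   Context: $M(n,\mathbb{C})$ is the set of $n\times n$ complex matrices, $U(n)$ is the group of $n\times n$ unitary matrices with respect to the standard hermitian inner product on $\mathbb{C}^n$, and $U^{\ast}$ is the conjugate transpose of $U$. A matrix $[a_{ij}]$ is called tridiagonal if $a_{ij}=0$ for all $1\leq i,j\leq n$ with $|i-j|\geq 2$. *)

theory Defs
  imports "Jordan_Normal_Form.Schur_Decomposition"
begin

definition unitary_mats :: "nat \<Rightarrow> complex mat set" where
  "unitary_mats n =
     {U \<in> carrier_mat n n. U * mat_adjoint U = 1\<^sub>m n \<and> mat_adjoint U * U = 1\<^sub>m n}"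

(* Matrices are indexed from 0 here. The difference is taken in int, since subtraction on nat
   truncates. *)
definition tridiagonal :: "'a :: zero mat \<Rightarrow> bool" where
  "tridiagonal A \<longleftrightarrow>
     (\<forall>i < dim_row A. \<forall>j < dim_col A. \<bar>int i - int j\<bar> \<ge> 2 \<longrightarrow> A $$ (i, j) = 0)"

lemma index_mat_adjoint_complex:
  fixes A :: "complex mat"
  assumes "A \<in> carrier_mat n n" and "i < n" and "j < n"
  shows "mat_adjoint A $$ (i, j) = cnj (A $$ (j, i))"
  using assms by (simp add: mat_adjoint_def mat_of_rows_index)

end

theory Submission
  imports "HOL-Complex_Analysis.Cauchy_Integral_Formula" Defs
begin

text \<open>
Write \<open>B = A\<^sup>*\<close>. Conjugating \<open>A\<close> to tridiagonal form by a unitary matrix amounts to finding an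
orthonormal basis; in dimension four, a basis \<open>e0, e1, e2, e3\<close> such that \<open>A\<close> and \<open>B\<close> both map
\<open>e0\<close> into the plane \<open>W\<close> spanned by \<open>e0, e1\<close>, and \<open>W\<close> into the space spanned by \<open>e0, e1, e2\<close>.
Only the flag of these three spaces matters, and in this form the problem is algebraic and makes sense
for any two matrices \<open>A\<close> and \<open>B\<close>.

The first condition says that \<open>v\<close>, \<open>A v\<close> and \<open>B v\<close> are linearly dependent for \<open>v = e0\<close>: up to
exchanging \<open>A\<close> and \<open>B\<close>, the vector \<open>v\<close> is an eigenvector of some \<open>B + y A\<close>. Then \<open>W\<close> is in
general spanned by \<open>v\<close> and \<open>A v\<close>, and the second condition says that \<open>v, A v, A A v, B A v\<close> are
linearly dependent: the quartic form \<open>det [v, A v, A A v, B A v]\<close> (\<open>flag_form\<close>) vanishes at \<open>v\<close>.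
So the point is to find an eigenvector of a member of the pencil at which this form is zero
(\<open>form_zero_on_pencil_eigenvector\<close>); from such a vector the basis is read off
(\<open>flag_basis_if_form_zero\<close>).

In general the eigenvectors of the members of the pencil form an algebraic curve, and a zero exists because
the form gives a section of a line bundle of positive degree on it. The following argument replaces the curve
by the complex line of the parameter \<open>y\<close>. Suppose that there is no zero. A matrix without a
cyclic vector has an eigenspace of dimension at least two, and a quartic form in two variables has a
nontrivial zero; hence
every member of the pencil has a cyclic vector \<open>u\<close> (\<open>cyclic_vector_if_no_eigenvector_zero\<close>).
For an eigenvalue \<open>a\<close> of \<open>M = B + y A\<close> the vector \<open>adj (a - M) u\<close> is then an eigenvector. Multiply
the values of the form at these four vectors and divide by the fourth power of the Krylov determinant
\<open>det [u, M u, M M u, M M M u]\<close>. This norm \<open>F y\<close> does not depend on \<open>u\<close>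
(\<open>eigen_norm_independent\<close>), so it is defined for all \<open>y\<close>; it is entire, because a symmetric
expression in the eigenvalues is a determinant (\<open>prod_eigenvalues_holomorphic\<close>), and it has no zeros.
At \<open>y = \<infinity>\<close> the pencil is \<open>A + z B\<close> with \<open>z = 1/y\<close>, and on its eigenvectors the form for \<open>(A, B)\<close>
is \<open>z\<^sup>3\<close> times the form for \<open>(B, A)\<close> (\<open>flag_form_swap\<close>). With the homogeneity of the norm this gives
\<open>F y = y\<^bsup>12\<^esup> * k (1/y)\<close>, where \<open>k\<close> is the norm for the exchanged pair and \<open>k 0\<close> is nonzero. So
\<open>1/F\<close> is entire and tends to zero at infinity, against Liouville's theorem.

In dimension three it is enough to start from an eigenvector of \<open>A\<close>, and in dimensions one and two
every matrix is tridiagonal.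
\<close>

unbundle no vec_syntax and no inner_syntax
hide_const (open) Determinants.det Finite_Cartesian_Product.mat Finite_Cartesian_Product.row
  Finite_Cartesian_Product.vec Coset.order
hide_const (open) Module.smult
hide_type (open) Finite_Cartesian_Product.vec

section \<open>Kernels and Krylov sequences\<close>

lemma det_zero_iff_left_kernel:
  fixes N :: "'a :: field mat"
  assumes N: "N \<in> carrier_mat n n"
  shows "det N = 0 \<longleftrightarrow> (\<exists>\<phi>\<in>carrier_vec n. \<phi> \<noteq> 0\<^sub>v n \<and> transpose_mat N *\<^sub>v \<phi> = 0\<^sub>v n)"
  using det_0_iff_vec_prod_zero[of "transpose_mat N" n] det_transpose[OF N] N by auto

text \<open>
A case of the equality of row rank and column rank: meeting every hyperplane \<open>l \<bullet> w = 0\<close> nontrivially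
says without dimensions that the kernel has dimension at least two.
The matrix \<open>N + x l\<^sup>T\<close> is singular for every \<open>x\<close>, since some nonzero combination \<open>\<chi>\<close> of \<open>\<phi>\<close>
and \<open>\<psi>\<close> annihilates \<open>x\<close>. If \<open>\<phi>\<close> does not annihilate \<open>x\<close>, a kernel vector \<open>w\<close> of this matrix
satisfies \<open>(l \<bullet> w) (\<phi> \<bullet> x) = 0\<close>, so it lies in the hyperplane and in the kernel of \<open>N\<close>.
\<close>

lemma left_kernel_dim_two_imp_kernel_dim_two:
  fixes N :: "'a :: field mat"
  assumes N: "N \<in> carrier_mat n n" and l: "l \<in> carrier_vec n"
    and \<phi>: "\<phi> \<in> carrier_vec n" "\<phi> \<noteq> 0\<^sub>v n" "transpose_mat N *\<^sub>v \<phi> = 0\<^sub>v n"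
    and \<psi>: "\<psi> \<in> carrier_vec n" "transpose_mat N *\<^sub>v \<psi> = 0\<^sub>v n"
    and indep: "\<And>c. \<psi> \<noteq> c \<cdot>\<^sub>v \<phi>"
  shows "\<exists>w\<in>carrier_vec n. w \<noteq> 0\<^sub>v n \<and> N *\<^sub>v w = 0\<^sub>v n \<and> l \<bullet> w = 0"
proof -
  obtain i where i: "i < n" "\<phi> $ i \<noteq> 0"
    using \<phi>(1,2) by (metis carrier_vecD eq_vecI index_zero_vec(1) index_zero_vec(2))
  define x :: "'a vec" where "x = unit_vec n i"
  have x: "x \<in> carrier_vec n" by (simp add: x_def)
  define \<chi> where "\<chi> = \<phi> $ i \<cdot>\<^sub>v \<psi> - \<psi> $ i \<cdot>\<^sub>v \<phi>"
  have \<chi>: "\<chi> \<in> carrier_vec n" using \<phi>(1) \<psi>(1) by (simp add: \<chi>_def)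
  have \<chi>0: "\<chi> \<noteq> 0\<^sub>v n"
  proof
    assume 0: "\<chi> = 0\<^sub>v n"
    have "\<psi> = (\<psi> $ i / \<phi> $ i) \<cdot>\<^sub>v \<phi>"
    proof (rule eq_vecI)
      fix j assume "j < dim_vec ((\<psi> $ i / \<phi> $ i) \<cdot>\<^sub>v \<phi>)"
      then have j: "j < n" using \<phi>(1) by auto
      have "\<chi> $ j = 0" using 0 j by simp
      then show "\<psi> $ j = ((\<psi> $ i / \<phi> $ i) \<cdot>\<^sub>v \<phi>) $ j"
        using j i \<phi>(1) \<psi>(1) by (simp add: \<chi>_def field_simps)
    qed (use \<phi>(1) \<psi>(1) in auto)
    then show False using indep by blast
  qed
  have \<chi>i: "\<chi> $ i = 0" using i \<phi>(1) \<psi>(1) by (simp add: \<chi>_def)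
  have N\<chi>: "transpose_mat N *\<^sub>v \<chi> = 0\<^sub>v n"
    unfolding \<chi>_def using N \<phi> \<psi>
    by (auto simp: mult_minus_distrib_mat_vec[where nr=n and nc=n] mult_mat_vec[where nr=n and nc=n]
        intro!: eq_vecI)
  define N' where "N' = mat n n (\<lambda>(r,c). N $$ (r,c) + x $ r * l $ c)"
  have N': "N' \<in> carrier_mat n n" by (simp add: N'_def)
  have "transpose_mat N' *\<^sub>v \<chi> = 0\<^sub>v n"
  proof (rule eq_vecI)
    fix c assume "c < dim_vec (0\<^sub>v n :: 'a vec)"
    then have c: "c < n" by simp
    have "(transpose_mat N' *\<^sub>v \<chi>) $ c = (\<Sum>r=0..<n. (N $$ (r,c) + x $ r * l $ c) * \<chi> $ r)"
      using c \<chi> by (simp add: N'_def scalar_prod_def)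
    also have "\<dots> = (\<Sum>r=0..<n. N $$ (r,c) * \<chi> $ r) + (\<Sum>r=0..<n. x $ r * \<chi> $ r) * l $ c"
      by (simp add: algebra_simps sum.distrib sum_distrib_left)
    also have "(\<Sum>r=0..<n. N $$ (r,c) * \<chi> $ r) = (transpose_mat N *\<^sub>v \<chi>) $ c"
      using c \<chi> N by (simp add: scalar_prod_def)
    also have "(\<Sum>r=0..<n. x $ r * \<chi> $ r) = x \<bullet> \<chi>"
      using \<chi> by (simp add: scalar_prod_def)
    also have "x \<bullet> \<chi> = 0" using \<chi>i i \<chi> by (simp add: x_def)
    finally show "(transpose_mat N' *\<^sub>v \<chi>) $ c = (0\<^sub>v n) $ c" using N\<chi> c by simp
  qed (use N' in auto)
  then have "det N' = 0" using det_zero_iff_left_kernel[OF N'] \<chi> \<chi>0 by blast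
  then obtain w where w: "w \<in> carrier_vec n" "w \<noteq> 0\<^sub>v n" "N' *\<^sub>v w = 0\<^sub>v n"
    using det_0_iff_vec_prod_zero[OF N'] by blast
  have split: "N' *\<^sub>v w = N *\<^sub>v w + (l \<bullet> w) \<cdot>\<^sub>v x"
    using w(1) N l x by (intro eq_vecI)
      (auto simp: N'_def scalar_prod_def algebra_simps sum.distrib sum_distrib_left)
  have "\<phi> \<bullet> (N *\<^sub>v w) = (transpose_mat N *\<^sub>v \<phi>) \<bullet> w"
    by (rule transpose_vec_mult_scalar[symmetric, OF N w(1) \<phi>(1)])
  also have "\<dots> = 0" using \<phi>(3) w(1) by simp
  finally have "\<phi> \<bullet> (N' *\<^sub>v w) = (l \<bullet> w) * \<phi> $ i"
    unfolding split using \<phi>(1) N w(1) i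
    by (simp add: scalar_prod_add_distrib[where n=n] x_def)
  then have lw: "l \<bullet> w = 0" using w(3) i \<phi>(1) by simp
  have "0 \<cdot>\<^sub>v x = 0\<^sub>v n" using x by auto
  then have "N *\<^sub>v w = 0\<^sub>v n" using split w(3) lw N w(1) by simp
  then show ?thesis using w lw by blast
qed

definition krylov :: "'a :: semiring_0 mat \<Rightarrow> 'a vec \<Rightarrow> nat \<Rightarrow> 'a vec" where
  "krylov M u k = ((\<lambda>x. M *\<^sub>v x) ^^ k) u"

lemma krylov_0 [simp]: "krylov M u 0 = u"
  by (simp add: krylov_def)

lemma krylov_Suc: "krylov M u (Suc k) = M *\<^sub>v krylov M u k"
  by (simp add: krylov_def)

lemma krylov_carrier [simp]:
  "M \<in> carrier_mat n n \<Longrightarrow> u \<in> carrier_vec n \<Longrightarrow> krylov M u k \<in> carrier_vec n"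
  by (induction k) (simp_all add: krylov_Suc)

lemma krylov_dim [simp]:
  "M \<in> carrier_mat n n \<Longrightarrow> u \<in> carrier_vec n \<Longrightarrow> dim_vec (krylov M u k) = n"
  using krylov_carrier carrier_vecD by blast

definition krylov_mat :: "nat \<Rightarrow> 'a :: semiring_0 mat \<Rightarrow> 'a vec \<Rightarrow> 'a mat" where
  "krylov_mat n M u = mat n n (\<lambda>(i,j). krylov M u j $ i)"

lemma krylov_mat_carrier [simp]: "krylov_mat n M u \<in> carrier_mat n n"
  by (simp add: krylov_mat_def)

text \<open>
The value \<open>p(M)\<close> of a polynomial at an \<open>n \<times> n\<close> matrix, by Horner's scheme (not a matrix of polynomials).
\<close>

definition poly_mat :: "nat \<Rightarrow> 'a :: field mat \<Rightarrow> 'a poly \<Rightarrow> 'a mat" where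
  "poly_mat n M p = fold_coeffs (\<lambda>a X. a \<cdot>\<^sub>m 1\<^sub>m n + M * X) p (0\<^sub>m n n)"

context
  fixes M :: "'a :: field mat" and n :: nat
  assumes M: "M \<in> carrier_mat n n"
begin

lemma poly_mat_0 [simp]: "poly_mat n M 0 = 0\<^sub>m n n"
  by (simp add: poly_mat_def)

lemma poly_mat_pCons: "poly_mat n M (pCons a p) = a \<cdot>\<^sub>m 1\<^sub>m n + M * poly_mat n M p"
proof (cases "a = 0 \<and> p = 0")
  case True
  then show ?thesis using M by (auto intro!: eq_matI)
next
  case False
  then show ?thesis by (auto simp: poly_mat_def)
qed

lemma poly_mat_carrier [simp]: "poly_mat n M p \<in> carrier_mat n n"
  by (induction p) (use M in \<open>auto simp: poly_mat_pCons\<close>)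

lemma poly_mat_dim [simp]: "dim_row (poly_mat n M p) = n" "dim_col (poly_mat n M p) = n"
  using poly_mat_carrier by blast+

lemma poly_mat_add: "poly_mat n M (p + q) = poly_mat n M p + poly_mat n M q"
proof (induction p q rule: poly_induct2)
  case (pCons a p b q)
  have "M * (poly_mat n M p + poly_mat n M q) = M * poly_mat n M p + M * poly_mat n M q"
    by (rule mult_add_distrib_mat[where nc=n, OF M]) simp_all
  moreover have "(a + b) \<cdot>\<^sub>m 1\<^sub>m n = a \<cdot>\<^sub>m 1\<^sub>m n + b \<cdot>\<^sub>m (1\<^sub>m n :: 'a mat)"
    by (rule add_smult_distrib_right_mat[where nr=n and nc=n]) simp
  ultimately show ?case
    using M by (auto simp: poly_mat_pCons pCons intro!: eq_matI)
qed auto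

lemma poly_mat_smult: "poly_mat n M (Polynomial.smult c p) = c \<cdot>\<^sub>m poly_mat n M p"
proof (induction p)
  case (pCons a p)
  have "M * (c \<cdot>\<^sub>m poly_mat n M p) = c \<cdot>\<^sub>m (M * poly_mat n M p)"
    by (rule mult_smult_distrib[where nc=n, OF M]) simp
  then show ?case using M by (auto simp: poly_mat_pCons pCons algebra_simps intro!: eq_matI)
qed (auto intro!: eq_matI)

lemma poly_mat_mult: "poly_mat n M (p * q) = poly_mat n M p * poly_mat n M q"
proof (induction p)
  case 0
  show ?case by (simp add: left_mult_zero_mat[where n=n])
next
  case (pCons a p)
  have "(a \<cdot>\<^sub>m 1\<^sub>m n) * poly_mat n M q = a \<cdot>\<^sub>m poly_mat n M q"
    by (simp add: mult_smult_assoc_mat[where nr=n and n=n and nc=n])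
  moreover have "(a \<cdot>\<^sub>m 1\<^sub>m n + M * poly_mat n M p) * poly_mat n M q =
      (a \<cdot>\<^sub>m 1\<^sub>m n) * poly_mat n M q + (M * poly_mat n M p) * poly_mat n M q"
    by (rule add_mult_distrib_mat[where nr=n and n=n and nc=n]) (use M in auto)
  moreover have "(M * poly_mat n M p) * poly_mat n M q = M * (poly_mat n M p * poly_mat n M q)"
    by (rule assoc_mult_mat[where n\<^sub>3=n and n\<^sub>4=n, OF M]) simp_all
  ultimately show ?case
    by (simp add: poly_mat_pCons poly_mat_add poly_mat_smult pCons) (use M in \<open>auto intro!: eq_matI\<close>)
qed

lemma poly_mat_const: "poly_mat n M [:a:] = a \<cdot>\<^sub>m 1\<^sub>m n"
  using M by (auto simp: poly_mat_pCons intro!: eq_matI)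

lemma poly_mat_linear: "poly_mat n M [:a, 1:] = a \<cdot>\<^sub>m 1\<^sub>m n + M"
  using M mult_smult_distrib[where nc=n, OF M one_carrier_mat, of 1]
  by (auto simp: poly_mat_pCons[of _ "[:1:]"] poly_mat_const intro!: eq_matI)

lemma poly_mat_commute: "M * poly_mat n M p = poly_mat n M p * M"
proof -
  have "poly_mat n M [:0,1:] = M" using M by (auto simp: poly_mat_linear intro!: eq_matI)
  then show ?thesis by (metis poly_mat_mult mult.commute)
qed

text \<open>
A uniform bound \<open>d\<close> instead of the degree makes the right hand side depend on the coefficients only,
which is what families of polynomials of varying degree require.
\<close>

lemma poly_mat_mult_vec:
  assumes u: "u \<in> carrier_vec n" and "degree p \<le> d"
  shows "poly_mat n M p *\<^sub>v u = vec n (\<lambda>i. \<Sum>k\<le>d. coeff p k * krylov M u k $ i)"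
  using assms(2)
proof (induction d arbitrary: p)
  case 0
  then obtain a where "p = [:a:]" using degree_eq_zeroE by blast
  then show ?case using u by (auto simp: poly_mat_const intro!: eq_vecI)
next
  case (Suc d)
  obtain a q where p: "p = pCons a q" by (cases p)
  have "degree q \<le> d" using Suc.prems by (cases "q = 0") (auto simp: p)
  note IH = Suc.IH[OF this]
  have "poly_mat n M p *\<^sub>v u = (a \<cdot>\<^sub>m 1\<^sub>m n) *\<^sub>v u + M *\<^sub>v (poly_mat n M q *\<^sub>v u)"
    unfolding p poly_mat_pCons
    by (subst add_mult_distrib_mat_vec[where nr=n and nc=n])
      (use M u in \<open>auto simp: assoc_mult_mat_vec[where n\<^sub>1=n and n\<^sub>2=n and n\<^sub>3=n]\<close>)
  also have "(a \<cdot>\<^sub>m 1\<^sub>m n) *\<^sub>v u = a \<cdot>\<^sub>v u" using u by auto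
  also have "M *\<^sub>v (poly_mat n M q *\<^sub>v u) =
      vec n (\<lambda>i. \<Sum>k\<le>d. coeff q k * krylov M u (Suc k) $ i)"
  proof (rule eq_vecI)
    fix i assume "i < dim_vec (vec n (\<lambda>i. \<Sum>k\<le>d. coeff q k * krylov M u (Suc k) $ i))"
    then have i: "i < n" by simp
    have "(M *\<^sub>v (poly_mat n M q *\<^sub>v u)) $ i =
        (\<Sum>j = 0..<n. M $$ (i,j) * (\<Sum>k\<le>d. coeff q k * krylov M u k $ j))"
      unfolding IH using M i by (simp add: scalar_prod_def)
    also have "\<dots> = (\<Sum>k\<le>d. coeff q k * (\<Sum>j = 0..<n. M $$ (i,j) * krylov M u k $ j))"
      unfolding sum_distrib_left by (subst sum.swap) (simp add: mult_ac)
    also have "\<dots> = (\<Sum>k\<le>d. coeff q k * krylov M u (Suc k) $ i)"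
      using M i u by (simp add: krylov_Suc scalar_prod_def)
    finally show "(M *\<^sub>v (poly_mat n M q *\<^sub>v u)) $ i =
       vec n (\<lambda>i. \<Sum>k\<le>d. coeff q k * krylov M u (Suc k) $ i) $ i" using i by simp
  qed (use M in simp)
  finally show ?case
    using u by (auto simp: p sum.atMost_Suc_shift simp del: sum.atMost_Suc intro!: eq_vecI)
qed

end

section \<open>Eigenvectors in invariant sets and cyclic vectors\<close>

lemma smult_mat_mult_vec:
  fixes A :: "'a :: comm_semiring_0 mat"
  assumes "A \<in> carrier_mat nr nc" "v \<in> carrier_vec nc"
  shows "(a \<cdot>\<^sub>m A) *\<^sub>v v = a \<cdot>\<^sub>v (A *\<^sub>v v)"
  using assms by (intro eq_vecI) (auto simp: scalar_prod_def sum_distrib_left mult_ac)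

lemma poly_with_coeffs:
  fixes c :: "'a :: zero vec"
  assumes c: "c \<in> carrier_vec m"
  obtains p where "\<And>k. coeff p k = (if k < m then c $ k else 0)"
proof
  show "coeff (Poly (list_of_vec c)) k = (if k < m then c $ k else 0)" for k
    using c by (auto simp: coeff_Poly_eq nth_default_def list_of_vec_index)
qed

text \<open>
The \<open>n + 1\<close> vectors \<open>w, M w, ..., M\<^sup>n w\<close> are dependent: padded with a zero row they form a singular
matrix, and a kernel vector of it is the coefficient vector of the polynomial.
\<close>

lemma annihilating_poly_exists:
  fixes M :: "'a :: field mat"
  assumes M: "M \<in> carrier_mat n n" and w: "w \<in> carrier_vec n"
  obtains p where "p \<noteq> 0" "poly_mat n M p *\<^sub>v w = 0\<^sub>v n"
proof -
  define K where "K = mat (Suc n) (Suc n) (\<lambda>(i,j). if i < n then krylov M w j $ i else 0)"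
  have K: "K \<in> carrier_mat (Suc n) (Suc n)" by (simp add: K_def)
  have "transpose_mat K *\<^sub>v unit_vec (Suc n) n = 0\<^sub>v (Suc n)"
    by (intro eq_vecI) (auto simp: K_def)
  then have "det K = 0"
    unfolding det_zero_iff_left_kernel[OF K] by (intro bexI[of _ "unit_vec (Suc n) n"]) auto
  then obtain c where c: "c \<in> carrier_vec (Suc n)" "c \<noteq> 0\<^sub>v (Suc n)" "K *\<^sub>v c = 0\<^sub>v (Suc n)"
    using det_0_iff_vec_prod_zero[OF K] by blast
  obtain p where p: "coeff p k = (if k < Suc n then c $ k else 0)" for k
    using poly_with_coeffs[OF c(1)] by blast
  have "p \<noteq> 0"
  proof
    assume "p = 0"
    then have "c = 0\<^sub>v (Suc n)"
      using p c(1) by (intro eq_vecI) (auto split: if_splits, metis)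
    then show False using c(2) by simp
  qed
  moreover have "degree p \<le> n" by (rule degree_le) (simp add: p)
  then have "poly_mat n M p *\<^sub>v w = vec n (\<lambda>i. (K *\<^sub>v c) $ i)"
    using c(1) by (subst poly_mat_mult_vec[OF M w])
      (auto simp: K_def scalar_prod_def p atLeast0LessThan lessThan_Suc_atMost mult.commute intro!: eq_vecI)
  then have "poly_mat n M p *\<^sub>v w = 0\<^sub>v n" by (auto simp: c(3) intro!: eq_vecI)
  ultimately show thesis by (rule that)
qed

text \<open>
Split an annihilating polynomial of \<open>w\<close> into linear factors \<open>M - a\<close> and apply them to \<open>w\<close> one
after the other: the last vector before the result becomes zero is an eigenvector, and it is still in
the invariant set.
\<close>

lemma eigenvector_in_invariant_set:
  fixes M :: "complex mat"
  assumes M: "M \<in> carrier_mat n n" and S: "S \<subseteq> carrier_vec n" and w: "w \<in> S" "w \<noteq> 0\<^sub>v n"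
    and inv: "\<And>x c. x \<in> S \<Longrightarrow> M *\<^sub>v x + c \<cdot>\<^sub>v x \<in> S"
  shows "\<exists>v\<in>S. v \<noteq> 0\<^sub>v n \<and> (\<exists>a. M *\<^sub>v v = a \<cdot>\<^sub>v v)"
proof -
  obtain p where p: "p \<noteq> 0" "poly_mat n M p *\<^sub>v w = 0\<^sub>v n"
    using annihilating_poly_exists[OF M] w(1) S by blast
  obtain as where as: "Polynomial.smult (lead_coeff p) (\<Prod>a\<leftarrow>as. [:- a, 1:]) = p"
    using fundamental_theorem_algebra_factorized[of p] by blast
  have "poly_mat n M (\<Prod>a\<leftarrow>as. [:- a, 1:]) *\<^sub>v w = 0\<^sub>v n" (is "?X = _")
  proof -
    have car: "?X \<in> carrier_vec n" using M w(1) S by (auto intro!: mult_mat_vec_carrier)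
    have "poly_mat n M p *\<^sub>v w = lead_coeff p \<cdot>\<^sub>v ?X"
      by (subst as[symmetric], unfold poly_mat_smult[OF M])
        (use M w(1) S in \<open>auto simp: smult_mat_mult_vec[where nr=n and nc=n]\<close>)
    then have "lead_coeff p \<cdot>\<^sub>v ?X = 0\<^sub>v n" using p(2) by simp
    then have "lead_coeff p * ?X $ i = 0" if "i < n" for i
      using that car by (metis carrier_vecD index_smult_vec(1) index_zero_vec(1))
    then show ?thesis using p(1) car M by (intro eq_vecI) auto
  qed
  then show ?thesis using w
  proof (induction as arbitrary: w)
    case Nil
    have "poly_mat n M 1 *\<^sub>v w = w"
      using poly_mat_const[OF M, of 1] Nil(2) S
      by (auto simp: one_pCons smult_mat_mult_vec[where nr=n and nc=n] intro!: eq_vecI)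
    then show ?case using Nil by simp
  next
    case (Cons a as)
    have wc: "w \<in> carrier_vec n" using Cons.prems S by blast
    define w' where "w' = M *\<^sub>v w + (-a) \<cdot>\<^sub>v w"
    have w': "w' \<in> S" unfolding w'_def by (rule inv) (rule Cons.prems)
    have lin: "poly_mat n M [:-a,1:] *\<^sub>v w = w'"
      using M wc unfolding poly_mat_linear[OF M] w'_def
      by (subst add_mult_distrib_mat_vec[where nr=n and nc=n])
        (auto simp: smult_mat_mult_vec[where nr=n and nc=n] intro!: eq_vecI)
    show ?case
    proof (cases "w' = 0\<^sub>v n")
      case True
      have "M *\<^sub>v w = a \<cdot>\<^sub>v w"
      proof (rule eq_vecI)
        fix i assume "i < dim_vec (a \<cdot>\<^sub>v w)"
        then have i: "i < n" using wc by simp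
        then have "w' $ i = 0" using True by simp
        then show "(M *\<^sub>v w) $ i = (a \<cdot>\<^sub>v w) $ i" using i M wc by (simp add: w'_def)
      qed (use M wc in auto)
      then show ?thesis using Cons.prems by blast
    next
      case False
      have eq: "(\<Prod>a\<leftarrow>a # as. [:- a, 1:]) = (\<Prod>a\<leftarrow>as. [:- a, 1:]) * [:-a, 1:]"
        by (simp add: mult.commute)
      have "poly_mat n M (\<Prod>a\<leftarrow>a # as. [:- a, 1:]) *\<^sub>v w =
          poly_mat n M (\<Prod>a\<leftarrow>as. [:- a, 1:]) *\<^sub>v w'"
        unfolding eq poly_mat_mult[OF M] lin[symmetric]
        by (rule assoc_mult_mat_vec[where n\<^sub>1=n and n\<^sub>2=n and n\<^sub>3=n]) (use M wc in auto)
      then show ?thesis using Cons.IH[OF _ w' False] Cons.prems by simp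
    qed
  qed
qed

lemma transpose_krylov_mat_mult_vec:
  fixes M :: "'a :: comm_semiring_0 mat"
  assumes M: "M \<in> carrier_mat n n" and u: "u \<in> carrier_vec n" and "\<phi> \<in> carrier_vec n"
  shows "transpose_mat (krylov_mat n M u) *\<^sub>v \<phi> = vec n (\<lambda>k. \<phi> \<bullet> krylov M u k)"
  using assms by (intro eq_vecI) (auto simp: krylov_mat_def scalar_prod_def mult.commute)

lemma det_krylov_zero_iff:
  fixes M :: "'a :: field mat"
  assumes M: "M \<in> carrier_mat n n" and u: "u \<in> carrier_vec n"
  shows "det (krylov_mat n M u) = 0 \<longleftrightarrow>
    (\<exists>\<phi>\<in>carrier_vec n. \<phi> \<noteq> 0\<^sub>v n \<and> (\<forall>k<n. \<phi> \<bullet> krylov M u k = 0))"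
proof -
  have "transpose_mat (krylov_mat n M u) *\<^sub>v \<phi> = 0\<^sub>v n \<longleftrightarrow> (\<forall>k<n. \<phi> \<bullet> krylov M u k = 0)"
    if "\<phi> \<in> carrier_vec n" for \<phi>
    unfolding transpose_krylov_mat_mult_vec[OF M u that] by (auto simp: vec_eq_iff)
  then show ?thesis by (auto simp: det_zero_iff_left_kernel[of _ n])
qed

lemma char_poly_eq_det:
  fixes M :: "'a :: field mat"
  assumes M: "M \<in> carrier_mat n n"
  shows "poly (char_poly M) a = det (a \<cdot>\<^sub>m 1\<^sub>m n - M)"
proof -
  have "- (char_matrix M a) = a \<cdot>\<^sub>m 1\<^sub>m n - M"
    using M by (auto simp: char_matrix_def intro!: eq_matI)
  then show ?thesis by (simp add: char_poly_matrix[OF M])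
qed

lemma transpose_eigen_iff:
  fixes M :: "'a :: field mat"
  assumes M: "M \<in> carrier_mat n n" and v: "\<phi> \<in> carrier_vec n"
  shows "transpose_mat (a \<cdot>\<^sub>m 1\<^sub>m n - M) *\<^sub>v \<phi> = 0\<^sub>v n \<longleftrightarrow> transpose_mat M *\<^sub>v \<phi> = a \<cdot>\<^sub>v \<phi>"
proof -
  have "transpose_mat (a \<cdot>\<^sub>m 1\<^sub>m n - M) = a \<cdot>\<^sub>m 1\<^sub>m n - transpose_mat M"
    using M by (auto intro!: eq_matI)
  moreover have "(a \<cdot>\<^sub>m 1\<^sub>m n - transpose_mat M) *\<^sub>v \<phi> = a \<cdot>\<^sub>v \<phi> - transpose_mat M *\<^sub>v \<phi>"
    using M v by (subst minus_mult_distrib_mat_vec[where nr=n and nc=n])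
      (auto simp: smult_mat_mult_vec[where nr=n and nc=n])
  ultimately show ?thesis using M v by (auto simp: vec_eq_iff)
qed

lemma krylov_left_eigenvector:
  fixes M :: "'a :: field mat"
  assumes M: "M \<in> carrier_mat n n" and u: "u \<in> carrier_vec n" and \<phi>: "\<phi> \<in> carrier_vec n"
    and eig: "transpose_mat M *\<^sub>v \<phi> = a \<cdot>\<^sub>v \<phi>"
  shows "\<phi> \<bullet> krylov M u k = a ^ k * (\<phi> \<bullet> u)"
proof (induction k)
  case (Suc k)
  have "\<phi> \<bullet> krylov M u (Suc k) = (transpose_mat M *\<^sub>v \<phi>) \<bullet> krylov M u k"
    unfolding krylov_Suc by (rule transpose_vec_mult_scalar[symmetric]) (use M u \<phi> in auto)
  then show ?case using Suc M u \<phi> by (simp add: eig)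
qed simp

text \<open>
If all left eigenspaces are lines, choose \<open>u\<close> outside the finitely many hyperplanes on which the left
eigenvectors vanish; a point \<open>(1, t, t\<^sup>2, ...)\<close> of the moment curve does it for all but finitely many
\<open>t\<close>. If \<open>u\<close> were not cyclic, the left vectors annihilating its whole Krylov sequence would form a nonzero space invariant under
the transposed matrix, and an eigenvector in this space would annihilate \<open>u\<close>.
\<close>

lemma cyclic_vector_or_left_eigenspace_dim_two:
  fixes M :: "complex mat"
  assumes M: "M \<in> carrier_mat n n"
  obtains (cyclic) u where "u \<in> carrier_vec n" "det (krylov_mat n M u) \<noteq> 0"
  | (eigenspace) a \<phi> \<psi> where "\<phi> \<in> carrier_vec n" "\<psi> \<in> carrier_vec n" "\<phi> \<noteq> 0\<^sub>v n" "\<And>c. \<psi> \<noteq> c \<cdot>\<^sub>v \<phi>"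
      "transpose_mat M *\<^sub>v \<phi> = a \<cdot>\<^sub>v \<phi>" "transpose_mat M *\<^sub>v \<psi> = a \<cdot>\<^sub>v \<psi>"
proof (cases "\<exists>a. \<exists>\<phi>\<in>carrier_vec n. \<exists>\<psi>\<in>carrier_vec n. \<phi> \<noteq> 0\<^sub>v n \<and> (\<forall>c. \<psi> \<noteq> c \<cdot>\<^sub>v \<phi>) \<and>
    transpose_mat M *\<^sub>v \<phi> = a \<cdot>\<^sub>v \<phi> \<and> transpose_mat M *\<^sub>v \<psi> = a \<cdot>\<^sub>v \<psi>")
  case True
  then show ?thesis using eigenspace by metis
next
  case False
  define R where "R = {a. poly (char_poly M) a = 0}"
  have "char_poly M \<noteq> 0" using degree_monic_char_poly[OF M] by auto
  then have R: "finite R" unfolding R_def by (rule poly_roots_finite)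
  have "\<exists>\<phi>\<in>carrier_vec n. \<phi> \<noteq> 0\<^sub>v n \<and> transpose_mat M *\<^sub>v \<phi> = a \<cdot>\<^sub>v \<phi>" if "a \<in> R" for a
  proof -
    have "det (a \<cdot>\<^sub>m 1\<^sub>m n - M) = 0" using that by (simp add: R_def char_poly_eq_det[OF M])
    then show ?thesis
      using det_zero_iff_left_kernel[of "a \<cdot>\<^sub>m 1\<^sub>m n - M" n] M transpose_eigen_iff[OF M]
      by (auto simp: minus_carrier_mat)
  qed
  then obtain \<phi> where \<phi>: "\<And>a. a \<in> R \<Longrightarrow> \<phi> a \<in> carrier_vec n" "\<And>a. a \<in> R \<Longrightarrow> \<phi> a \<noteq> 0\<^sub>v n"
    "\<And>a. a \<in> R \<Longrightarrow> transpose_mat M *\<^sub>v \<phi> a = a \<cdot>\<^sub>v \<phi> a"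
    by metis
  have "\<exists>p. \<forall>k. coeff p k = (if k < n then \<phi> a $ k else 0)" if "a \<in> R" for a
    using poly_with_coeffs[OF \<phi>(1)[OF that]] by blast
  then obtain P where P: "\<And>a k. a \<in> R \<Longrightarrow> coeff (P a) k = (if k < n then \<phi> a $ k else 0)"
    by metis
  have P0: "P a \<noteq> 0" if "a \<in> R" for a
  proof
    assume "P a = 0"
    then have "\<phi> a = 0\<^sub>v n"
      using P[OF that] \<phi>(1)[OF that] by (intro eq_vecI) (auto split: if_splits, metis)
    then show False using \<phi>(2)[OF that] by simp
  qed
  have "finite {t. poly (\<Prod>a\<in>R. P a) t = 0}"
    by (rule poly_roots_finite) (use R P0 in simp)
  then obtain t where t: "poly (\<Prod>a\<in>R. P a) t \<noteq> 0"
    by (metis (mono_tags, lifting) ex_new_if_finite infinite_UNIV_char_0 mem_Collect_eq)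
  define u where "u = vec n (\<lambda>k. t ^ k)"
  have u: "u \<in> carrier_vec n" by (simp add: u_def)
  have \<phi>u: "\<phi> a \<bullet> u \<noteq> 0" if "a \<in> R" for a
  proof -
    have "poly (P a) t = (\<Sum>k<n. coeff (P a) k * t ^ k)"
    proof (cases "n = 0")
      case True
      then show ?thesis using P0[OF that] P[OF that] by (auto simp: poly_eq_iff)
    next
      case False
      then have "degree (P a) \<le> n - 1" by (intro degree_le) (auto simp: P[OF that])
      then have "(\<Sum>k\<le>degree (P a). coeff (P a) k * t ^ k) = (\<Sum>k<n. coeff (P a) k * t ^ k)"
        using False by (intro sum.mono_neutral_left) (auto simp: coeff_eq_0)
      then show ?thesis by (simp add: poly_altdef)
    qed
    also have "\<dots> = \<phi> a \<bullet> u"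
      using P[OF that] by (simp add: u_def scalar_prod_def atLeast0LessThan)
    finally show ?thesis using t that R by (auto simp: poly_prod)
  qed
  have "det (krylov_mat n M u) \<noteq> 0"
  proof
    assume det: "det (krylov_mat n M u) = 0"
    then obtain \<psi> where \<psi>: "\<psi> \<in> carrier_vec n" "\<psi> \<noteq> 0\<^sub>v n" "\<And>k. k < n \<Longrightarrow> \<psi> \<bullet> krylov M u k = 0"
      using det_krylov_zero_iff[OF M u] by blast
    obtain c where c: "c \<in> carrier_vec n" "c \<noteq> 0\<^sub>v n" "krylov_mat n M u *\<^sub>v c = 0\<^sub>v n"
      using det det_0_iff_vec_prod_zero[OF krylov_mat_carrier] by blast
    \<comment> \<open>The relation \<open>c\<close> between the Krylov vectors, read off at its last nonzero coefficient \<open>m\<close>,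
      reduces every later Krylov vector to earlier ones.\<close>
    define m where "m = Max {k. k < n \<and> c $ k \<noteq> 0}"
    have "{k. k < n \<and> c $ k \<noteq> 0} \<noteq> {}"
      using c(1,2) by (auto simp: vec_eq_iff)
    then have "m \<in> {k. k < n \<and> c $ k \<noteq> 0}" unfolding m_def by (intro Max_in) auto
    then have m: "m < n" "c $ m \<noteq> 0" by auto
    have above: "c $ k = 0" if "m < k" "k < n" for k
      using that Max_ge[of "{k. k < n \<and> c $ k \<noteq> 0}" k] unfolding m_def[symmetric] by force
    have split: "(\<Sum>k<n. c $ k * f k) = (\<Sum>k<m. c $ k * f k) + c $ m * f m" for f :: "nat \<Rightarrow> complex"
    proof -
      have "(\<Sum>k<n. c $ k * f k) = (\<Sum>k<Suc m. c $ k * f k)"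
        by (rule sum.mono_neutral_right) (use m above in auto)
      then show ?thesis by simp
    qed
    have rel: "(\<Sum>k<n. c $ k * (x \<bullet> krylov M u (k + l))) = 0" if "x \<in> carrier_vec n" for x l
      using that
    proof (induction l arbitrary: x)
      case 0
      have "0 = x \<bullet> (krylov_mat n M u *\<^sub>v c)" using c(3) 0 by simp
      also have "\<dots> = (transpose_mat (krylov_mat n M u) *\<^sub>v x) \<bullet> c"
        by (rule transpose_vec_mult_scalar[symmetric, OF _ c(1) 0]) simp
      also have "\<dots> = (\<Sum>k<n. c $ k * (x \<bullet> krylov M u k))"
        unfolding transpose_krylov_mat_mult_vec[OF M u 0] using c(1)
        by (simp add: scalar_prod_def atLeast0LessThan mult.commute)
      finally show ?case by simp
    next
      case (Suc l)
      have "x \<bullet> krylov M u (Suc k) = (transpose_mat M *\<^sub>v x) \<bullet> krylov M u k" for k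
        unfolding krylov_Suc by (rule transpose_vec_mult_scalar[symmetric]) (use M u Suc.prems in auto)
      then show ?case using Suc.IH[of "transpose_mat M *\<^sub>v x"] M Suc.prems by simp
    qed
    have all: "\<psi> \<bullet> krylov M u k = 0" for k
    proof (induction k rule: less_induct)
      case (less k)
      show ?case
      proof (cases "k < n")
        case False
        then have k: "m + (k - m) = k" using m by simp
        have "(\<Sum>j<m. c $ j * (\<psi> \<bullet> krylov M u (j + (k - m)))) = 0"
          by (rule sum.neutral) (use False m less in auto)
        then have "c $ m * (\<psi> \<bullet> krylov M u k) = 0"
          using rel[OF \<psi>(1), of "k - m"] split[of "\<lambda>j. \<psi> \<bullet> krylov M u (j + (k - m))"] k by simp
        then show ?thesis using m by simp
      qed (use \<psi> in simp)
    qed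
    define S where "S = {x \<in> carrier_vec n. \<forall>k. x \<bullet> krylov M u k = 0}"
    have "\<exists>v\<in>S. v \<noteq> 0\<^sub>v n \<and> (\<exists>a. transpose_mat M *\<^sub>v v = a \<cdot>\<^sub>v v)"
    proof (rule eigenvector_in_invariant_set)
      fix x b assume x: "x \<in> S"
      have "(transpose_mat M *\<^sub>v x) \<bullet> krylov M u k = x \<bullet> krylov M u (Suc k)" for k
        unfolding krylov_Suc by (rule transpose_vec_mult_scalar) (use M u x in \<open>auto simp: S_def\<close>)
      then show "transpose_mat M *\<^sub>v x + b \<cdot>\<^sub>v x \<in> S"
        using x M u by (auto simp: S_def add_scalar_prod_distrib[where n=n])
    qed (use M \<psi> all in \<open>auto simp: S_def\<close>)
    then obtain \<chi> a where \<chi>: "\<chi> \<in> carrier_vec n" "\<chi> \<noteq> 0\<^sub>v n" "transpose_mat M *\<^sub>v \<chi> = a \<cdot>\<^sub>v \<chi>"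
      and \<chi>u: "\<chi> \<bullet> krylov M u 0 = 0" unfolding S_def by blast
    have "det (a \<cdot>\<^sub>m 1\<^sub>m n - M) = 0"
      using det_zero_iff_left_kernel[of "a \<cdot>\<^sub>m 1\<^sub>m n - M" n] M transpose_eigen_iff[OF M \<chi>(1)] \<chi>
      by (auto simp: minus_carrier_mat)
    then have aR: "a \<in> R" by (simp add: R_def char_poly_eq_det[OF M])
    then obtain d where d: "\<phi> a = d \<cdot>\<^sub>v \<chi>" using False \<phi>[OF aR] \<chi> by metis
    then show False using \<phi>u[OF aR] \<chi>u \<chi>(1) u by simp
  qed
  then show ?thesis using cyclic u by blast
qed

section \<open>Eigenvectors from the adjugate\<close>

lemma prod_list_map_mult:
  "(\<Prod>x\<leftarrow>xs. f x * g x) = (\<Prod>x\<leftarrow>xs. f x) * (\<Prod>x\<leftarrow>xs. g x :: 'a :: comm_monoid_mult)"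
  by (induction xs) (auto simp: ac_simps)

text \<open>
Both sides are multiplicative in \<open>p\<close>, so it suffices to compare them on linear factors, where the
equation is the factorization of the characteristic polynomial.
\<close>

lemma det_poly_mat:
  fixes M :: "complex mat"
  assumes M: "M \<in> carrier_mat n n" and cp: "char_poly M = (\<Prod>a\<leftarrow>as. [:- a, 1:])"
  shows "det (poly_mat n M p) = (\<Prod>a\<leftarrow>as. poly p a)"
proof -
  have len: "length as = n"
    using degree_monic_char_poly[OF M] degree_linear_factors[of uminus as] by (simp add: cp)
  have const: "det (poly_mat n M [:c:]) = c ^ n" for c
    by (simp add: poly_mat_const[OF M])
  have linear: "det (poly_mat n M [:-r, 1:]) = (\<Prod>a\<leftarrow>as. a - r)" for r
  proof -
    have "poly_mat n M [:-r, 1:] = (-1) \<cdot>\<^sub>m (r \<cdot>\<^sub>m 1\<^sub>m n - M)"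
      using M by (auto simp: poly_mat_linear[OF M] intro!: eq_matI)
    then have "det (poly_mat n M [:-r, 1:]) = (-1) ^ n * poly (char_poly M) r"
      using M by (simp add: char_poly_eq_det[OF M])
    also have "\<dots> = (-1) ^ length as * (\<Prod>a\<leftarrow>as. r - a)"
      by (simp add: cp len poly_prod_list o_def)
    also have "\<dots> = (\<Prod>a\<leftarrow>as. a - r)" by (induction as) (auto simp: algebra_simps)
    finally show ?thesis .
  qed
  have factors: "det (poly_mat n M (\<Prod>r\<leftarrow>rs. [:-r, 1:])) = (\<Prod>a\<leftarrow>as. \<Prod>r\<leftarrow>rs. a - r)" for rs
  proof (induction rs)
    case Nil
    show ?case using const[of 1] by (simp add: one_pCons map_replicate_const)
  next
    case (Cons r rs)
    show ?case
      by (simp only: list.map prod_list.Cons poly_mat_mult[OF M])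
        (subst det_mult[where n=n], use M Cons in \<open>auto simp: linear prod_list_map_mult\<close>)
  qed
  obtain rs where rs: "Polynomial.smult (lead_coeff p) (\<Prod>r\<leftarrow>rs. [:- r, 1:]) = p"
    using fundamental_theorem_algebra_factorized[of p] by blast
  have "det (poly_mat n M p) = lead_coeff p ^ n * (\<Prod>a\<leftarrow>as. \<Prod>r\<leftarrow>rs. a - r)"
    using M by (subst rs[symmetric], unfold poly_mat_smult[OF M]) (simp add: factors)
  also have "\<dots> = (\<Prod>a\<leftarrow>as. lead_coeff p * (\<Prod>r\<leftarrow>rs. a - r))"
    unfolding prod_list_map_mult by (simp add: map_replicate_const len)
  also have "\<dots> = (\<Prod>a\<leftarrow>as. poly p a)"
  proof -
    have "poly p a = lead_coeff p * (\<Prod>r\<leftarrow>rs. a - r)" for a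
      using arg_cong[OF rs, of "\<lambda>q. poly q a"] by (simp add: poly_prod_list o_def)
    then show ?thesis by simp
  qed
  finally show ?thesis .
qed

text \<open>
When \<open>a\<close> is an eigenvalue, the nonzero columns of this matrix are eigenvectors. Unlike arbitrarily chosen
eigenvectors they depend polynomially on \<open>a\<close> and on the entries of \<open>M\<close>.
\<close>

definition eigen_adj :: "nat \<Rightarrow> 'a :: comm_ring_1 mat \<Rightarrow> 'a \<Rightarrow> 'a mat" where
  "eigen_adj n M a = adj_mat (a \<cdot>\<^sub>m 1\<^sub>m n - M)"

context
  fixes M :: "'a :: field mat" and n :: nat and a :: 'a
  assumes M: "M \<in> carrier_mat n n"
begin

lemma eigen_adj_carrier [simp]: "eigen_adj n M a \<in> carrier_mat n n"
  unfolding eigen_adj_def using M by (intro adj_mat) (auto simp: minus_carrier_mat)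

lemma eigen_adj_dim [simp]: "dim_row (eigen_adj n M a) = n" "dim_col (eigen_adj n M a) = n"
  using eigen_adj_carrier by blast+

context
  assumes a: "poly (char_poly M) a = 0"
begin

lemma mult_eigen_adj: "M * eigen_adj n M a = a \<cdot>\<^sub>m eigen_adj n M a"
  and eigen_adj_mult: "eigen_adj n M a * M = a \<cdot>\<^sub>m eigen_adj n M a"
proof -
  let ?N = "a \<cdot>\<^sub>m 1\<^sub>m n - M"
  have N: "?N \<in> carrier_mat n n" using M by (simp add: minus_carrier_mat)
  have det: "det ?N = 0" using a by (simp add: char_poly_eq_det[OF M])
  have 1: "?N * eigen_adj n M a = 0\<^sub>m n n" "eigen_adj n M a * ?N = 0\<^sub>m n n"
    using adj_mat(2,3)[OF N] unfolding eigen_adj_def det by auto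
  have 2: "?N * eigen_adj n M a = a \<cdot>\<^sub>m eigen_adj n M a - M * eigen_adj n M a"
    using M by (subst minus_mult_distrib_mat[where nr=n and n=n and nc=n])
      (auto simp: mult_smult_assoc_mat[where nr=n and n=n and nc=n])
  have 3: "eigen_adj n M a * ?N = a \<cdot>\<^sub>m eigen_adj n M a - eigen_adj n M a * M"
    using M by (subst mult_minus_distrib_mat[where nr=n and n=n and nc=n])
      (auto simp: mult_smult_distrib[where nr=n and n=n and nc=n])
  show "M * eigen_adj n M a = a \<cdot>\<^sub>m eigen_adj n M a" 
  proof (rule eq_matI)
    fix i j assume "i < dim_row (a \<cdot>\<^sub>m eigen_adj n M a)" "j < dim_col (a \<cdot>\<^sub>m eigen_adj n M a)"
    then have ij: "i < n" "j < n" by auto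
    have "(a \<cdot>\<^sub>m eigen_adj n M a - M * eigen_adj n M a) $$ (i,j) = 0"
      unfolding 2[symmetric] 1 using ij by simp
    then show "(M * eigen_adj n M a) $$ (i,j) = (a \<cdot>\<^sub>m eigen_adj n M a) $$ (i,j)"
      using ij M by simp
  qed (use M in auto)
  show "eigen_adj n M a * M = a \<cdot>\<^sub>m eigen_adj n M a"
  proof (rule eq_matI)
    fix i j assume "i < dim_row (a \<cdot>\<^sub>m eigen_adj n M a)" "j < dim_col (a \<cdot>\<^sub>m eigen_adj n M a)"
    then have ij: "i < n" "j < n" by auto
    have "(a \<cdot>\<^sub>m eigen_adj n M a - eigen_adj n M a * M) $$ (i,j) = 0"
      unfolding 3[symmetric] 1 using ij by simp
    then show "(eigen_adj n M a * M) $$ (i,j) = (a \<cdot>\<^sub>m eigen_adj n M a) $$ (i,j)"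
      using ij M by simp
  qed (use M in auto)
qed

lemma eigen_adj_mult_vec_eigen:
  assumes u: "u \<in> carrier_vec n"
  shows "M *\<^sub>v (eigen_adj n M a *\<^sub>v u) = a \<cdot>\<^sub>v (eigen_adj n M a *\<^sub>v u)"
  by (metis M assoc_mult_mat_vec eigen_adj_carrier mult_eigen_adj smult_mat_mult_vec u)

text \<open>
Replacing \<open>u\<close> by \<open>p(M) u\<close> only rescales the eigenvector that belongs to \<open>a\<close>, by the factor \<open>p(a)\<close>.
\<close>

lemma eigen_adj_poly_mat:
  "eigen_adj n M a * poly_mat n M p = poly p a \<cdot>\<^sub>m eigen_adj n M a"
proof (induction p)
  case 0
  show ?case using M by (auto intro!: eq_matI)
next
  case (pCons c p)
  have "eigen_adj n M a * poly_mat n M (pCons c p) =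
      eigen_adj n M a * (c \<cdot>\<^sub>m 1\<^sub>m n) + eigen_adj n M a * (M * poly_mat n M p)"
    unfolding poly_mat_pCons[OF M]
    by (rule mult_add_distrib_mat[where nr=n and n=n and nc=n]) (use M in auto)
  also have "eigen_adj n M a * (M * poly_mat n M p) = (eigen_adj n M a * M) * poly_mat n M p"
    by (rule assoc_mult_mat[symmetric, where n\<^sub>1=n and n\<^sub>2=n and n\<^sub>3=n and n\<^sub>4=n]) (use M in auto)
  also have "\<dots> = a \<cdot>\<^sub>m (poly p a \<cdot>\<^sub>m eigen_adj n M a)"
    unfolding eigen_adj_mult pCons.IH[symmetric]
    by (rule mult_smult_assoc_mat[where nr=n and n=n and nc=n]) (use M in auto)
  also have "eigen_adj n M a * (c \<cdot>\<^sub>m 1\<^sub>m n) = c \<cdot>\<^sub>m eigen_adj n M a"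
    by (subst mult_smult_distrib[where nr=n and n=n and nc=n])
      (auto simp: right_mult_one_mat[where nr=n and nc=n])
  finally show ?case using M by (auto simp: algebra_simps intro!: eq_matI)
qed

end
end

text \<open>
Choose \<open>w\<close> in the kernel of \<open>N\<close> with \<open>w $ j\<close> nonzero. By Cramer's rule, replacing column \<open>j\<close> of
\<open>N\<close> by \<open>u\<close> gives a singular matrix. A left kernel vector of this matrix annihilates \<open>u\<close> and all the
other columns of \<open>N\<close>, and hence also column \<open>j\<close>, which is a combination of the others because of \<open>w\<close>.
\<close>

lemma adj_mat_mult_vec_zero:
  fixes N :: "'a :: field mat"
  assumes N: "N \<in> carrier_mat n n" and u: "u \<in> carrier_vec n" and det: "det N = 0"
    and adj: "adj_mat N *\<^sub>v u = 0\<^sub>v n"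
  shows "\<exists>\<phi>\<in>carrier_vec n. \<phi> \<noteq> 0\<^sub>v n \<and> transpose_mat N *\<^sub>v \<phi> = 0\<^sub>v n \<and> \<phi> \<bullet> u = 0"
proof -
  obtain w where w: "w \<in> carrier_vec n" "w \<noteq> 0\<^sub>v n" "N *\<^sub>v w = 0\<^sub>v n"
    using det det_0_iff_vec_prod_zero[OF N] by blast
  obtain j where j: "j < n" "w $ j \<noteq> 0"
    using w(1,2) by (metis carrier_vecD eq_vecI index_zero_vec(1) index_zero_vec(2))
  let ?R = "replace_col N u j"
  have R: "?R \<in> carrier_mat n n" using N by (auto simp: replace_col_def)
  have "det ?R = (adj_mat N *\<^sub>v u) $ j"
    using u j N by (subst laplace_expansion_column[OF R j(1)])
      (auto simp: replace_col_def adj_mat_def scalar_prod_def cofactor_def mat_delete_def mult_ac atLeast0LessThan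
         intro!: sum.cong arg_cong[of _ _ det] arg_cong[of _ _ "\<lambda>x. _ * x"] eq_matI)
  then have "det ?R = 0" using adj j by simp
  then obtain \<phi> where \<phi>: "\<phi> \<in> carrier_vec n" "\<phi> \<noteq> 0\<^sub>v n" "transpose_mat ?R *\<^sub>v \<phi> = 0\<^sub>v n"
    using det_zero_iff_left_kernel[OF R] by blast
  have "(transpose_mat ?R *\<^sub>v \<phi>) $ j = \<phi> \<bullet> u"
    using j N u \<phi>(1) by (simp add: replace_col_def scalar_prod_def mult.commute)
  then have \<phi>u: "\<phi> \<bullet> u = 0" using \<phi>(3) j by simp
  have other: "(transpose_mat N *\<^sub>v \<phi>) $ k = 0" if k: "k < n" "k \<noteq> j" for k
  proof -
    have "(transpose_mat N *\<^sub>v \<phi>) $ k = (transpose_mat ?R *\<^sub>v \<phi>) $ k"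
      using k N \<phi>(1) by (simp add: replace_col_def scalar_prod_def)
    then show ?thesis using \<phi>(3) k by simp
  qed
  have "0 = \<phi> \<bullet> (N *\<^sub>v w)" using w(3) \<phi>(1) by simp
  also have "\<dots> = (transpose_mat N *\<^sub>v \<phi>) \<bullet> w"
    by (rule transpose_vec_mult_scalar[symmetric, OF N w(1) \<phi>(1)])
  also have "\<dots> = (\<Sum>k\<in>{0..<n}. (transpose_mat N *\<^sub>v \<phi>) $ k * w $ k)"
    using w(1) by (simp add: scalar_prod_def)
  also have "\<dots> = (\<Sum>k\<in>{j}. (transpose_mat N *\<^sub>v \<phi>) $ k * w $ k)"
    by (rule sum.mono_neutral_right) (use j other in auto)
  finally have "(transpose_mat N *\<^sub>v \<phi>) $ j = 0" using j by simp
  then have "transpose_mat N *\<^sub>v \<phi> = 0\<^sub>v n"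
    using other N by (intro eq_vecI) (metis index_zero_vec(1,2), simp)
  then show ?thesis using \<phi> \<phi>u by blast
qed

text \<open>
Otherwise some left eigenvector annihilates \<open>u\<close>, and with it the whole Krylov sequence of \<open>u\<close>.
\<close>

lemma eigen_adj_cyclic_nonzero:
  fixes M :: "'a :: field mat"
  assumes M: "M \<in> carrier_mat n n" and u: "u \<in> carrier_vec n" and a: "poly (char_poly M) a = 0"
    and cyc: "det (krylov_mat n M u) \<noteq> 0"
  shows "eigen_adj n M a *\<^sub>v u \<noteq> 0\<^sub>v n"
proof
  assume 0: "eigen_adj n M a *\<^sub>v u = 0\<^sub>v n"
  have N: "a \<cdot>\<^sub>m 1\<^sub>m n - M \<in> carrier_mat n n" using M by (simp add: minus_carrier_mat)
  obtain \<phi> where \<phi>: "\<phi> \<in> carrier_vec n" "\<phi> \<noteq> 0\<^sub>v n"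
      "transpose_mat (a \<cdot>\<^sub>m 1\<^sub>m n - M) *\<^sub>v \<phi> = 0\<^sub>v n" "\<phi> \<bullet> u = 0"
    using adj_mat_mult_vec_zero[OF N u _ 0[unfolded eigen_adj_def]] a char_poly_eq_det[OF M] by auto
  then have "transpose_mat M *\<^sub>v \<phi> = a \<cdot>\<^sub>v \<phi>" using transpose_eigen_iff[OF M \<phi>(1)] by simp
  then have "\<phi> \<bullet> krylov M u k = 0" for k
    using krylov_left_eigenvector[OF M u \<phi>(1)] \<phi>(4) by simp
  then show False using cyc det_krylov_zero_iff[OF M u] \<phi>(1,2) by blast
qed

lemma krylov_poly_mat:
  fixes M :: "'a :: field mat"
  assumes M: "M \<in> carrier_mat n n" and u: "u \<in> carrier_vec n"
  shows "krylov M (poly_mat n M p *\<^sub>v u) k = poly_mat n M p *\<^sub>v krylov M u k"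
proof (induction k)
  case (Suc k)
  have "M *\<^sub>v (poly_mat n M p *\<^sub>v krylov M u k) = (M * poly_mat n M p) *\<^sub>v krylov M u k"
    by (rule assoc_mult_mat_vec[symmetric, where n\<^sub>1=n and n\<^sub>2=n and n\<^sub>3=n]) (use M u in auto)
  also have "\<dots> = poly_mat n M p *\<^sub>v (M *\<^sub>v krylov M u k)"
    unfolding poly_mat_commute[OF M]
    by (rule assoc_mult_mat_vec[where n\<^sub>1=n and n\<^sub>2=n and n\<^sub>3=n]) (use M u in auto)
  finally show ?case using Suc by (simp add: krylov_Suc)
qed simp

lemma det_krylov_poly_mat:
  fixes M :: "'a :: field mat"
  assumes M: "M \<in> carrier_mat n n" and u: "u \<in> carrier_vec n"
  shows "det (krylov_mat n M (poly_mat n M p *\<^sub>v u)) = det (poly_mat n M p) * det (krylov_mat n M u)"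
proof -
  have "krylov_mat n M (poly_mat n M p *\<^sub>v u) = poly_mat n M p * krylov_mat n M u"
  proof (rule eq_matI)
    fix i j assume "i < dim_row (poly_mat n M p * krylov_mat n M u)"
      and "j < dim_col (poly_mat n M p * krylov_mat n M u)"
    then have ij: "i < n" "j < n" using M by (auto simp: krylov_mat_def)
    have "col (krylov_mat n M u) j = krylov M u j"
      using ij M u by (auto simp: krylov_mat_def intro!: eq_vecI)
    then show "krylov_mat n M (poly_mat n M p *\<^sub>v u) $$ (i,j) = (poly_mat n M p * krylov_mat n M u) $$ (i,j)"
      using ij M u by (simp add: krylov_mat_def krylov_poly_mat[OF M u])
  qed (use M in \<open>auto simp: krylov_mat_def\<close>)
  then show ?thesis using M by (simp add: det_mult[where n=n])
qed

lemma cyclic_vector_generates: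
  fixes M :: "'a :: field mat"
  assumes M: "M \<in> carrier_mat n n" and u: "u \<in> carrier_vec n" and v: "v \<in> carrier_vec n"
    and cyc: "det (krylov_mat n M u) \<noteq> 0"
  obtains p where "v = poly_mat n M p *\<^sub>v u"
proof (cases "n = 0")
  case True
  then have "v = poly_mat n M 0 *\<^sub>v u" using M u v by auto
  then show ?thesis by (rule that)
next
  case False
  let ?K = "krylov_mat n M u"
  obtain J where J: "J \<in> carrier_mat n n" "?K * J = 1\<^sub>m n"
    using det_non_zero_imp_unit[OF krylov_mat_carrier cyc, of n]
    unfolding Units_def ring_mat_def by auto
  define c where "c = J *\<^sub>v v"
  have c: "c \<in> carrier_vec n" using J v by (simp add: c_def)
  have Kc: "?K *\<^sub>v c = v"
    unfolding c_def using J v by (metis assoc_mult_mat_vec krylov_mat_carrier one_mult_mat_vec)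
  obtain p where p: "coeff p k = (if k < n then c $ k else 0)" for k
    using poly_with_coeffs[OF c] by blast
  have "degree p \<le> n - 1" by (rule degree_le) (auto simp: p)
  moreover have "{..n - 1} = {0..<n}" using False by auto
  ultimately have "poly_mat n M p *\<^sub>v u = vec n (\<lambda>i. (?K *\<^sub>v c) $ i)"
    using c by (subst poly_mat_mult_vec[OF M u])
      (auto simp: krylov_mat_def scalar_prod_def p mult.commute intro!: eq_vecI)
  also have "\<dots> = v" unfolding Kc using v by auto
  finally show ?thesis using that by metis
qed

section \<open>Holomorphic dependence of symmetric functions of the eigenvalues\<close>

text \<open>
Determinants, adjugates and Krylov vectors are polynomial in the matrix entries, so they stay in any
algebra of functions that contains the entries. This is used for the entire functions of one variable
\<open>y\<close>, and for the functions of \<open>(y, a)\<close> that are entire in \<open>y\<close> and polynomial in \<open>a\<close>.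
\<close>

locale function_algebra =
  fixes P :: "('x \<Rightarrow> complex) \<Rightarrow> bool"
  assumes const: "\<And>c. P (\<lambda>_. c)"
    and add: "\<And>f g. P f \<Longrightarrow> P g \<Longrightarrow> P (\<lambda>x. f x + g x)"
    and mult: "\<And>f g. P f \<Longrightarrow> P g \<Longrightarrow> P (\<lambda>x. f x * g x)"
begin

lemma sum: "(\<And>i. i \<in> I \<Longrightarrow> P (f i)) \<Longrightarrow> P (\<lambda>x. \<Sum>i\<in>I. f i x)"
  by (induction I rule: infinite_finite_induct) (auto intro: const add)

lemma prod: "(\<And>i. i \<in> I \<Longrightarrow> P (f i)) \<Longrightarrow> P (\<lambda>x. \<Prod>i\<in>I. f i x)"
  by (induction I rule: infinite_finite_induct) (auto intro: const mult)

lemma diff: "P f \<Longrightarrow> P g \<Longrightarrow> P (\<lambda>x. f x - g x)"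
  using add[OF _ mult[OF const, of g "-1"], of f] by simp

definition vec_family :: "nat \<Rightarrow> ('x \<Rightarrow> complex vec) \<Rightarrow> bool" where
  "vec_family n v \<longleftrightarrow> (\<forall>x. v x \<in> carrier_vec n) \<and> (\<forall>i<n. P (\<lambda>x. v x $ i))"

definition mat_family :: "nat \<Rightarrow> ('x \<Rightarrow> complex mat) \<Rightarrow> bool" where
  "mat_family n M \<longleftrightarrow> (\<forall>x. M x \<in> carrier_mat n n) \<and> (\<forall>i<n. \<forall>j<n. P (\<lambda>x. M x $$ (i,j)))"

lemma vec_family_const: "v \<in> carrier_vec n \<Longrightarrow> vec_family n (\<lambda>_. v)"
  by (simp add: vec_family_def const)

lemma mat_family_const: "M \<in> carrier_mat n n \<Longrightarrow> mat_family n (\<lambda>_. M)"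
  by (simp add: mat_family_def const)

lemma mat_family_mat: "(\<And>i j. i < n \<Longrightarrow> j < n \<Longrightarrow> P (\<lambda>x. f x i j)) \<Longrightarrow>
    mat_family n (\<lambda>x. mat n n (\<lambda>(i,j). f x i j))"
  by (simp add: mat_family_def)

lemma vec_family_mult:
  assumes M: "mat_family n M" and v: "vec_family n v"
  shows "vec_family n (\<lambda>x. M x *\<^sub>v v x)"
proof -
  have "P (\<lambda>x. (M x *\<^sub>v v x) $ i)" if i: "i < n" for i
  proof -
    have "(\<lambda>x. (M x *\<^sub>v v x) $ i) = (\<lambda>x. \<Sum>j\<in>{0..<n}. M x $$ (i,j) * v x $ j)"
    proof
      fix x
      have "M x \<in> carrier_mat n n" "v x \<in> carrier_vec n"
        using M v by (auto simp: mat_family_def vec_family_def)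
      then show "(M x *\<^sub>v v x) $ i = (\<Sum>j\<in>{0..<n}. M x $$ (i,j) * v x $ j)"
        using i by (simp add: scalar_prod_def)
    qed
    then show ?thesis
      using M v i by (auto simp: mat_family_def vec_family_def intro!: sum mult)
  qed
  then show ?thesis
    using M v by (auto simp: mat_family_def vec_family_def intro!: mult_mat_vec_carrier[where n=n])
qed

lemma vec_family_krylov:
  "mat_family n M \<Longrightarrow> vec_family n u \<Longrightarrow> vec_family n (\<lambda>x. krylov (M x) (u x) k)"
  by (induction k) (auto simp: krylov_Suc intro: vec_family_mult)

lemma det: "mat_family n M \<Longrightarrow> P (\<lambda>x. det (M x))"
proof -
  assume M: "mat_family n M"
  have "(\<lambda>x. det (M x)) = (\<lambda>x. \<Sum>p\<in>{p. p permutes {0..<n}}. signof p * (\<Prod>i = 0..<n. M x $$ (i, p i)))"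
    using M by (auto simp: det_def' mat_family_def)
  moreover have "p i < n" if "p permutes {0..<n}" "i < n" for p i
    using that permutes_in_image[of p "{0..<n}" i] by auto
  ultimately show ?thesis using M by (auto simp: mat_family_def intro!: sum mult const prod)
qed

lemma mat_family_adj:
  assumes M: "mat_family n M"
  shows "mat_family n (\<lambda>x. adj_mat (M x))"
proof -
  have car: "M x \<in> carrier_mat n n" for x using M by (simp add: mat_family_def)
  have "P (\<lambda>x. adj_mat (M x) $$ (i,j))" if ij: "i < n" "j < n" for i j
  proof -
    have "mat_family (n - 1) (\<lambda>x. mat_delete (M x) j i)"
      using M unfolding mat_family_def mat_delete_def by (auto simp: carrier_matD[OF car])
    then have "P (\<lambda>x. (-1) ^ (j + i) * det (mat_delete (M x) j i))" by (intro mult const det)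
    moreover have "adj_mat (M x) $$ (i,j) = (-1) ^ (j + i) * det (mat_delete (M x) j i)" for x
      using ij car[of x] by (simp add: adj_mat_def cofactor_def)
    ultimately show ?thesis by simp
  qed
  then show ?thesis using adj_mat(1)[OF car] by (simp add: mat_family_def)
qed

end

interpretation holo: function_algebra "\<lambda>f. f holomorphic_on UNIV"
  by unfold_locales (auto intro: holomorphic_intros)

text \<open>
The bound on the degrees is what makes \<open>p y\<close>, evaluated at a matrix that depends on \<open>y\<close>, a sum of a fixed
number of holomorphic terms.
\<close>

definition poly_family :: "(complex \<times> complex \<Rightarrow> complex) \<Rightarrow> bool" where
  "poly_family f \<longleftrightarrow> (\<exists>p d. (\<forall>k. (\<lambda>y. coeff (p y) k) holomorphic_on UNIV) \<and>
     (\<forall>y. degree (p y) \<le> d) \<and> (\<forall>y a. f (y, a) = poly (p y) a))"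

lemma poly_familyI:
  assumes "\<And>k. (\<lambda>y. coeff (p y) k) holomorphic_on UNIV" "\<And>y. degree (p y) \<le> d"
    "\<And>y a. f (y, a) = poly (p y) a"
  shows "poly_family f"
  using assms unfolding poly_family_def by blast

interpretation pfam: function_algebra poly_family
proof
  show "poly_family (\<lambda>_. c)" for c
    by (rule poly_familyI[where p = "\<lambda>_. [:c:]" and d = 0]) auto
next
  fix f g assume "poly_family f" "poly_family g"
  then obtain p d q e where p: "\<And>k. (\<lambda>y. coeff (p y) k) holomorphic_on UNIV" "\<And>y. degree (p y) \<le> d"
      "\<And>y a. f (y, a) = poly (p y) a"
    and q: "\<And>k. (\<lambda>y. coeff (q y) k) holomorphic_on UNIV" "\<And>y. degree (q y) \<le> e"
      "\<And>y a. g (y, a) = poly (q y) a"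
    unfolding poly_family_def by blast
  show "poly_family (\<lambda>x. f x + g x)"
  proof (rule poly_familyI[where p = "\<lambda>y. p y + q y" and d = "max d e"])
    show "degree (p y + q y) \<le> max d e" for y
      using p(2)[of y] q(2)[of y] by (intro degree_add_le) auto
  qed (use p q in \<open>auto intro!: holomorphic_intros\<close>)
  show "poly_family (\<lambda>x. f x * g x)"
  proof (rule poly_familyI[where p = "\<lambda>y. p y * q y" and d = "d + e"])
    show "degree (p y * q y) \<le> d + e" for y
      using degree_mult_le[of "p y" "q y"] p(2)[of y] q(2)[of y] by simp
  qed (use p q in \<open>auto simp: coeff_mult intro!: holomorphic_intros\<close>)
qed

lemma poly_family_fst: "f holomorphic_on UNIV \<Longrightarrow> poly_family (\<lambda>x. f (fst x))"
proof (rule poly_familyI[where p = "\<lambda>y. [:f y:]" and d = 0])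
  show "(\<lambda>y. coeff [:f y:] k) holomorphic_on UNIV" if "f holomorphic_on UNIV" for k
    using that by (cases k) auto
qed auto

lemma poly_family_snd: "poly_family snd"
  by (rule poly_familyI[where p = "\<lambda>_. [:0,1:]" and d = 1]) auto

lemma prod_char_roots:
  fixes M :: "complex mat"
  assumes "char_poly M = (\<Prod>a\<leftarrow>as. [:- a, 1:])"
  shows "(\<Prod>a\<in>#proots (char_poly M). f a) = (\<Prod>a\<leftarrow>as. f a)"
proof -
  have "proots (\<Prod>a\<leftarrow>as. [:- a, 1:]) = mset as"
  proof (induction as)
    case (Cons a as)
    have "proots ([:- a, 1:] * (\<Prod>a\<leftarrow>as. [:- a, 1:])) = {#a#} + mset as"
      by (subst proots_mult) (auto simp: Cons prod_list_zero_iff)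
    then show ?case by simp
  qed simp
  then show ?thesis by (simp add: assms flip: prod_mset_prod_list)
qed

text \<open>
The single eigenvalues are in general not holomorphic in \<open>y\<close>. But \<open>f (y, a)\<close> is a polynomial \<open>p\<close> in
\<open>a\<close>, and the product of its values at all eigenvalues is the determinant of \<open>p(M)\<close>, whose entries are
holomorphic.
\<close>

lemma prod_eigenvalues_holomorphic:
  assumes M: "holo.mat_family n M" and f: "poly_family f"
  shows "(\<lambda>y. \<Prod>a\<in>#proots (char_poly (M y)). f (y, a)) holomorphic_on UNIV"
proof -
  obtain p d where p: "\<And>k. (\<lambda>y. coeff (p y) k) holomorphic_on UNIV" "\<And>y. degree (p y) \<le> d"
      "\<And>y a. f (y, a) = poly (p y) a"
    using f unfolding poly_family_def by blast
  have car: "M y \<in> carrier_mat n n" for y using M by (simp add: holo.mat_family_def)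
  have "(\<Prod>a\<in>#proots (char_poly (M y)). f (y, a)) = det (poly_mat n (M y) (p y))" for y
    using char_poly_factorized[OF car[of y]] det_poly_mat[OF car[of y]] prod_char_roots
    by (auto simp: p(3))
  moreover have "holo.mat_family n (\<lambda>y. poly_mat n (M y) (p y))"
  proof -
    have "(\<lambda>y. poly_mat n (M y) (p y) $$ (i,j)) holomorphic_on UNIV" if ij: "i < n" "j < n" for i j
    proof -
      have "poly_mat n (M y) (p y) $$ (i,j) =
          (\<Sum>k\<le>d. coeff (p y) k * krylov (M y) (unit_vec n j) k $ i)" for y
      proof -
        have "(poly_mat n (M y) (p y) *\<^sub>v unit_vec n j) $ i = poly_mat n (M y) (p y) $$ (i,j)"
          using ij car[of y] by simp
        then show ?thesis
          using ij by (simp add: poly_mat_mult_vec[OF car _ p(2)])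
      qed
      moreover have "(\<lambda>y. krylov (M y) (unit_vec n j) k $ i) holomorphic_on UNIV" for k
        using holo.vec_family_krylov[OF M holo.vec_family_const, of "unit_vec n j" k] ij
        by (simp add: holo.vec_family_def)
      ultimately show ?thesis using p(1) by (auto intro!: holomorphic_intros)
    qed
    then show ?thesis using car by (simp add: holo.mat_family_def)
  qed
  ultimately show ?thesis using holo.det by simp
qed

section \<open>The quartic form\<close>

text \<open>
Let \<open>v\<close> be an eigenvector of some \<open>D + y C\<close>, and let \<open>v\<close> and \<open>C v\<close> span a plane. Then \<open>D v\<close> lies in
this plane, so the form vanishes at \<open>v\<close> exactly when \<open>C\<close> and \<open>D\<close> map the plane into a common
three-dimensional space that contains it.
\<close>

definition flag_form :: "complex mat \<Rightarrow> complex mat \<Rightarrow> complex vec \<Rightarrow> complex" where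
  "flag_form C D v = det (mat_of_cols 4 [v, C *\<^sub>v v, C *\<^sub>v (C *\<^sub>v v), D *\<^sub>v (C *\<^sub>v v)])"

lemma all_less_4: "(\<forall>i<(4::nat). Q i) \<longleftrightarrow> Q 0 \<and> Q 1 \<and> Q 2 \<and> Q 3"
  by (auto simp: numeral_eq_Suc less_Suc_eq)

lemma less_4_cases: "i < (4::nat) \<Longrightarrow> i = 0 \<or> i = 1 \<or> i = 2 \<or> i = 3"
  by auto

lemma sum_0_4: "(\<Sum>k = 0..<4. f k) = f 0 + f 1 + f 2 + f (3::nat)"
  by (simp add: numeral_eq_Suc)

lemma flag_form_smult:
  assumes C: "C \<in> carrier_mat 4 4" and D: "D \<in> carrier_mat 4 4" and v: "v \<in> carrier_vec 4"
  shows "flag_form C D (c \<cdot>\<^sub>v v) = c ^ 4 * flag_form C D v"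
proof -
  have "mat_of_cols 4 [c \<cdot>\<^sub>v v, C *\<^sub>v (c \<cdot>\<^sub>v v), C *\<^sub>v (C *\<^sub>v (c \<cdot>\<^sub>v v)), D *\<^sub>v (C *\<^sub>v (c \<cdot>\<^sub>v v))] =
      c \<cdot>\<^sub>m mat_of_cols 4 [v, C *\<^sub>v v, C *\<^sub>v (C *\<^sub>v v), D *\<^sub>v (C *\<^sub>v v)]"
  proof (rule eq_matI, goal_cases)
    case (1 i j)
    then have "i < 4" "j < 4" by auto
    then show ?case
      using less_4_cases[of j] C D v by (auto simp: mat_of_cols_index mult_mat_vec[where nr=4 and nc=4])
  qed auto
  then show ?thesis by (simp add: flag_form_def power4_eq_xxxx)
qed

lemma (in function_algebra) flag_form:
  assumes C: "C \<in> carrier_mat 4 4" and D: "D \<in> carrier_mat 4 4" and v: "vec_family 4 v"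
  shows "P (\<lambda>x. flag_form C D (v x))"
proof -
  note 1 = vec_family_mult[OF mat_family_const[OF C] v]
  note 2 = vec_family_mult[OF mat_family_const[OF C] 1] vec_family_mult[OF mat_family_const[OF D] 1]
  have "mat_family 4 (\<lambda>x. mat_of_cols 4 [v x, C *\<^sub>v v x, C *\<^sub>v (C *\<^sub>v v x), D *\<^sub>v (C *\<^sub>v v x)])"
    using v 1 2 unfolding mat_family_def vec_family_def
    by (auto simp: all_less_4 mat_of_cols_index simp del: index_mult_mat_vec)
  then show ?thesis unfolding flag_form_def by (rule det)
qed

text \<open>
Substituting \<open>A v = a v - z B v\<close> expresses the four columns of the form for \<open>(A, B)\<close> by those of the
form for \<open>(B, A)\<close>. The transition matrix \<open>T\<close> has determinant \<open>z\<^sup>3\<close>: after exchanging its last two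
columns it is triangular with diagonal \<open>1, -z, -z, -z\<close>.
\<close>

lemma flag_form_swap:
  assumes A: "A \<in> carrier_mat 4 4" and B: "B \<in> carrier_mat 4 4" and v: "v \<in> carrier_vec 4"
    and eig: "(A + z \<cdot>\<^sub>m B) *\<^sub>v v = a \<cdot>\<^sub>v v"
  shows "flag_form A B v = z ^ 3 * flag_form B A v"
proof -
  have Av: "A *\<^sub>v v = a \<cdot>\<^sub>v v - z \<cdot>\<^sub>v (B *\<^sub>v v)"
  proof -
    have "(A + z \<cdot>\<^sub>m B) *\<^sub>v v = A *\<^sub>v v + z \<cdot>\<^sub>v (B *\<^sub>v v)"
      using A B v by (subst add_mult_distrib_mat_vec[where nr=4 and nc=4])
        (auto simp: smult_mat_mult_vec[where nr=4 and nc=4])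
    then have "A *\<^sub>v v + z \<cdot>\<^sub>v (B *\<^sub>v v) = a \<cdot>\<^sub>v v" using eig by simp
    then have *: "(A *\<^sub>v v) $ i + z * (B *\<^sub>v v) $ i = a * v $ i" if "i < 4" for i
      using that A B v by (metis carrier_vecD index_add_vec(1) index_smult_vec(1,2) carrier_matD(1) dim_mult_mat_vec)
    show ?thesis
      using A B v * by (intro eq_vecI) (auto simp del: index_mult_mat_vec simp: algebra_simps)
  qed
  have lin: "X *\<^sub>v (A *\<^sub>v v) = a \<cdot>\<^sub>v (X *\<^sub>v v) - z \<cdot>\<^sub>v (X *\<^sub>v (B *\<^sub>v v))" if "X \<in> carrier_mat 4 4" for X
    unfolding Av using that B v
    by (simp add: mult_minus_distrib_mat_vec[where nr=4 and nc=4] mult_mat_vec[where nr=4 and nc=4])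
  define T where "T = mat_of_rows_list 4 [[1, a, a\<^sup>2, 0], [0, -z, - a * z, a], [0, 0, 0, -z], [0, 0, -z, 0]]"
  have T: "T \<in> carrier_mat 4 4" by (rule carrier_matI) (simp_all add: T_def mat_of_rows_list_def)
  let ?W = "mat_of_cols 4 [v, B *\<^sub>v v, B *\<^sub>v (B *\<^sub>v v), A *\<^sub>v (B *\<^sub>v v)]"
  have W: "?W \<in> carrier_mat 4 4" by (rule carrier_matI) simp_all
  have "mat_of_cols 4 [v, A *\<^sub>v v, A *\<^sub>v (A *\<^sub>v v), B *\<^sub>v (A *\<^sub>v v)] = ?W * T"
  proof (rule eq_matI)
    fix i j assume "i < dim_row (?W * T)" "j < dim_col (?W * T)"
    then have ij: "i < 4" "j < 4" using T by auto
    show "mat_of_cols 4 [v, A *\<^sub>v v, A *\<^sub>v (A *\<^sub>v v), B *\<^sub>v (A *\<^sub>v v)] $$ (i, j) = (?W * T) $$ (i,j)"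
      using less_4_cases[OF ij(2)] ij(1) A B v unfolding lin[OF A] lin[OF B] unfolding Av
      by (elim disjE)
        (simp_all add: mat_of_cols_index scalar_prod_def T_def mat_of_rows_list_def sum_0_4
            algebra_simps power2_eq_square del: index_mult_mat_vec)
  qed (use T in auto)
  moreover have "det T = z ^ 3"
  proof -
    let ?U = "swapcols 2 3 T"
    have U: "?U \<in> carrier_mat 4 4" using T by auto
    have dim: "dim_row T = 4" "dim_col T = 4" using T by auto
    have T_entry: "T $$ (i, j) =
        [[1, a, a\<^sup>2, 0], [0, -z, - a * z, a], [0, 0, 0, -z], [0, 0, -z, 0]] ! i ! j"
      if "i < 4" "j < 4" for i j
      using that by (simp add: T_def mat_of_rows_list_def)
    have "upper_triangular ?U"
      unfolding upper_triangular_def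
    proof (intro allI impI)
      fix i j assume "i < dim_row ?U" "j < i"
      then have "i = 1 \<and> j = 0 \<or> i = 2 \<and> j = 0 \<or> i = 2 \<and> j = 1 \<or>
          i = 3 \<and> j = 0 \<or> i = 3 \<and> j = 1 \<or> i = 3 \<and> j = 2"
        by (auto simp: dim)
      then show "?U $$ (i, j) = 0" by (auto simp: dim T_entry)
    qed
    then have "det ?U = prod_list (diag_mat ?U)" by (rule det_upper_triangular[OF _ U])
    also have "\<dots> = - (z ^ 3)"
      by (simp add: diag_mat_def dim T_entry upt_rec power3_eq_cube)
    finally show ?thesis using det_swapcols[of 2 4 3 T] T by simp
  qed
  ultimately show ?thesis
    unfolding flag_form_def by (simp add: det_mult[OF W T])
qed

text \<open>
Without zeros, \<open>1/h\<close> would be entire and tend to zero at infinity.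
\<close>

lemma entire_pole_at_infinity_has_zero:
  assumes h: "h holomorphic_on UNIV" and k: "isCont k 0" "k 0 \<noteq> 0" and m: "m > 0"
    and hk: "\<And>y. y \<noteq> 0 \<Longrightarrow> h y = y ^ m * k (1 / y)"
  shows "\<exists>y. h y = (0::complex)"
proof (rule ccontr)
  assume nz: "\<nexists>y. h y = 0"
  have inv0: "((\<lambda>y::complex. 1 / y) \<longlongrightarrow> 0) at_infinity"
    using tendsto_inverse_0[where 'a=complex] by (simp add: inverse_eq_divide[abs_def])
  have "((\<lambda>y. k (1 / y)) \<longlongrightarrow> k 0) at_infinity"
    by (rule isCont_tendsto_compose[OF k(1) inv0])
  then have "((\<lambda>y. (1 / y) ^ m / k (1 / y)) \<longlongrightarrow> 0 ^ m / k 0) at_infinity"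
    using k(2) by (intro tendsto_divide tendsto_power inv0)
  moreover have "eventually (\<lambda>y. (1 / y) ^ m / k (1 / y) = 1 / h y) at_infinity"
    unfolding eventually_at_infinity
  proof (intro exI[of _ 1] allI impI)
    fix y :: complex assume "1 \<le> norm y"
    then have "y \<noteq> 0" by auto
    then show "(1 / y) ^ m / k (1 / y) = 1 / h y" by (simp add: hk power_one_over)
  qed
  ultimately have "((\<lambda>y. 1 / h y) \<longlongrightarrow> 0 ^ m / k 0) at_infinity"
    by (rule Lim_transform_eventually)
  then have "((\<lambda>y. 1 / h y) \<longlongrightarrow> 0) at_infinity" using m by (simp add: power_0_left)
  moreover have "(\<lambda>y. 1 / h y) holomorphic_on UNIV"
    using h nz by (auto intro!: holomorphic_intros)
  ultimately have "1 / h 0 = 0" by (rule Liouville_weak_0[rotated])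
  then show False using nz by simp
qed

section \<open>The norm of a form over the eigenvectors of a matrix\<close>

text \<open>
The product of the values of a form \<open>q\<close> of degree \<open>d\<close> at eigenvectors of \<open>M\<close>, one for each eigenvalue
with multiplicity. The denominator cancels the dependence on the cyclic vector \<open>u\<close> that scales the
eigenvectors. For a matrix without cyclic vector the value is meaningless.
\<close>

definition eigen_norm :: "nat \<Rightarrow> nat \<Rightarrow> (complex vec \<Rightarrow> complex) \<Rightarrow> complex mat \<Rightarrow> complex" where
  "eigen_norm n d q M = (let u = SOME u. u \<in> carrier_vec n \<and> det (krylov_mat n M u) \<noteq> 0
     in (\<Prod>a\<in>#proots (char_poly M). q (eigen_adj n M a *\<^sub>v u)) / det (krylov_mat n M u) ^ d)"

lemma proots_char_poly:
  fixes M :: "complex mat"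
  assumes M: "M \<in> carrier_mat n n"
  shows "a \<in># proots (char_poly M) \<longleftrightarrow> poly (char_poly M) a = 0" "size (proots (char_poly M)) = n"
    "char_poly M \<noteq> 0"
proof -
  show "char_poly M \<noteq> 0" using degree_monic_char_poly[OF M] by auto
  then show "a \<in># proots (char_poly M) \<longleftrightarrow> poly (char_poly M) a = 0" by simp
  show "size (proots (char_poly M)) = n"
    using degree_monic_char_poly[OF M] by (simp add: size_proots_complex)
qed

lemma prod_mset_image_power: "(\<Prod>x\<in>#A. f x ^ d) = (\<Prod>x\<in>#A. f x :: 'a :: comm_monoid_mult) ^ d"
  by (induction A) (auto simp: power_mult_distrib)

text \<open>
Another cyclic vector is \<open>p(M) u\<close> for a polynomial \<open>p\<close>. It multiplies the numerator by the product of
\<open>p(a)\<^sup>d\<close> over the eigenvalues \<open>a\<close>, which is \<open>det (p(M))\<^sup>d\<close>, and the Krylov determinant by \<open>det (p(M))\<close>.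
\<close>

lemma eigen_norm_independent:
  fixes M :: "complex mat"
  assumes M: "M \<in> carrier_mat n n"
    and q: "\<And>c v. v \<in> carrier_vec n \<Longrightarrow> q (c \<cdot>\<^sub>v v) = c ^ d * q v"
    and u: "u \<in> carrier_vec n" "det (krylov_mat n M u) \<noteq> 0"
    and v: "v \<in> carrier_vec n" "det (krylov_mat n M v) \<noteq> 0"
  shows "(\<Prod>a\<in>#proots (char_poly M). q (eigen_adj n M a *\<^sub>v v)) / det (krylov_mat n M v) ^ d =
    (\<Prod>a\<in>#proots (char_poly M). q (eigen_adj n M a *\<^sub>v u)) / det (krylov_mat n M u) ^ d"
proof -
  obtain p where p: "v = poly_mat n M p *\<^sub>v u" using cyclic_vector_generates[OF M u(1) v(1) u(2)] .
  obtain as where as: "char_poly M = (\<Prod>a\<leftarrow>as. [:- a, 1:])" using char_poly_factorized[OF M] by blast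
  have *: "q (eigen_adj n M a *\<^sub>v v) = poly p a ^ d * q (eigen_adj n M a *\<^sub>v u)"
    if "a \<in># proots (char_poly M)" for a
  proof -
    have a: "poly (char_poly M) a = 0" using that proots_char_poly[OF M] by simp
    have "eigen_adj n M a *\<^sub>v v = (eigen_adj n M a * poly_mat n M p) *\<^sub>v u"
      unfolding p using M u by (simp add: assoc_mult_mat_vec[where n\<^sub>1=n and n\<^sub>2=n and n\<^sub>3=n])
    also have "\<dots> = poly p a \<cdot>\<^sub>v (eigen_adj n M a *\<^sub>v u)"
      unfolding eigen_adj_poly_mat[OF M a] by (rule smult_mat_mult_vec) (use M u in auto)
    finally show ?thesis using q[of "eigen_adj n M a *\<^sub>v u"] M u by (simp add: mult_mat_vec_carrier[where n=n])
  qed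
  have "(\<Prod>a\<in>#proots (char_poly M). q (eigen_adj n M a *\<^sub>v v)) =
      (\<Prod>a\<in>#proots (char_poly M). poly p a ^ d * q (eigen_adj n M a *\<^sub>v u))"
    by (intro arg_cong[of _ _ prod_mset] image_mset_cong) (rule *)
  also have "\<dots> = (\<Prod>a\<in>#proots (char_poly M). poly p a) ^ d * (\<Prod>a\<in>#proots (char_poly M). q (eigen_adj n M a *\<^sub>v u))"
    by (simp add: prod_mset.distrib prod_mset_image_power)
  also have "(\<Prod>a\<in>#proots (char_poly M). poly p a) = det (poly_mat n M p)"
    unfolding det_poly_mat[OF M as] by (rule prod_char_roots[OF as])
  finally show ?thesis
    using u(2) v(2) det_krylov_poly_mat[OF M u(1), of p] by (simp add: p power_mult_distrib)
qed

lemma eigen_norm_eq: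
  fixes M :: "complex mat"
  assumes "M \<in> carrier_mat n n"
    and "\<And>c v. v \<in> carrier_vec n \<Longrightarrow> q (c \<cdot>\<^sub>v v) = c ^ d * q v"
    and "u \<in> carrier_vec n" "det (krylov_mat n M u) \<noteq> 0"
  shows "eigen_norm n d q M =
    (\<Prod>a\<in>#proots (char_poly M). q (eigen_adj n M a *\<^sub>v u)) / det (krylov_mat n M u) ^ d"
proof -
  define v where "v = (SOME u. u \<in> carrier_vec n \<and> det (krylov_mat n M u) \<noteq> 0)"
  have "v \<in> carrier_vec n \<and> det (krylov_mat n M v) \<noteq> 0"
    unfolding v_def by (rule someI[of _ u]) (use assms in simp)
  then show ?thesis
    using eigen_norm_independent[OF assms(1) _ assms(3,4), of q d v] assms(2)
    by (simp add: eigen_norm_def v_def[symmetric])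
qed

lemma eigen_norm_nonzero:
  fixes M :: "complex mat"
  assumes M: "M \<in> carrier_mat n n"
    and q: "\<And>c v. v \<in> carrier_vec n \<Longrightarrow> q (c \<cdot>\<^sub>v v) = c ^ d * q v"
    and u: "u \<in> carrier_vec n" "det (krylov_mat n M u) \<noteq> 0"
    and nz: "\<And>v a. v \<in> carrier_vec n \<Longrightarrow> v \<noteq> 0\<^sub>v n \<Longrightarrow> M *\<^sub>v v = a \<cdot>\<^sub>v v \<Longrightarrow> q v \<noteq> 0"
  shows "eigen_norm n d q M \<noteq> 0"
proof -
  have "q (eigen_adj n M a *\<^sub>v u) \<noteq> 0" if "a \<in># proots (char_poly M)" for a
  proof (rule nz)
    have a: "poly (char_poly M) a = 0" using that proots_char_poly[OF M] by simp
    show "M *\<^sub>v (eigen_adj n M a *\<^sub>v u) = a \<cdot>\<^sub>v (eigen_adj n M a *\<^sub>v u)"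
      by (rule eigen_adj_mult_vec_eigen[OF M a u(1)])
    show "eigen_adj n M a *\<^sub>v u \<noteq> 0\<^sub>v n" by (rule eigen_adj_cyclic_nonzero[OF M u(1) a u(2)])
    show "eigen_adj n M a *\<^sub>v u \<in> carrier_vec n" using M u by (simp add: mult_mat_vec_carrier[where n=n])
  qed
  moreover have eq: "eigen_norm n d q (M) =
      (\<Prod>a\<in>#proots (char_poly (M)). q (eigen_adj n (M) a *\<^sub>v u)) / det (krylov_mat n (M) u) ^ d"
    by (rule eigen_norm_eq) (use M q u in auto)
  ultimately show ?thesis unfolding eq using u(2) by (auto simp: prod_mset_zero_iff)
qed

lemma eigen_norm_cong:
  fixes M :: "complex mat"
  assumes M: "M \<in> carrier_mat n n"
    and q: "\<And>c v. v \<in> carrier_vec n \<Longrightarrow> q (c \<cdot>\<^sub>v v) = c ^ d * q v"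
    and r: "\<And>c v. v \<in> carrier_vec n \<Longrightarrow> r (c \<cdot>\<^sub>v v) = c ^ d * r v"
    and u: "u \<in> carrier_vec n" "det (krylov_mat n M u) \<noteq> 0"
    and qr: "\<And>v a. v \<in> carrier_vec n \<Longrightarrow> M *\<^sub>v v = a \<cdot>\<^sub>v v \<Longrightarrow> q v = c * r v"
  shows "eigen_norm n d q M = c ^ n * eigen_norm n d r M"
proof -
  have "q (eigen_adj n M a *\<^sub>v u) = c * r (eigen_adj n M a *\<^sub>v u)" if "a \<in># proots (char_poly M)" for a
  proof (rule qr)
    have a: "poly (char_poly M) a = 0" using that proots_char_poly[OF M] by simp
    show "M *\<^sub>v (eigen_adj n M a *\<^sub>v u) = a \<cdot>\<^sub>v (eigen_adj n M a *\<^sub>v u)"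
      by (rule eigen_adj_mult_vec_eigen[OF M a u(1)])
    show "eigen_adj n M a *\<^sub>v u \<in> carrier_vec n" using M u by (simp add: mult_mat_vec_carrier[where n=n])
  qed
  then have "(\<Prod>a\<in>#proots (char_poly M). q (eigen_adj n M a *\<^sub>v u)) =
      (\<Prod>a\<in>#proots (char_poly M). c * r (eigen_adj n M a *\<^sub>v u))"
    by (intro arg_cong[of _ _ prod_mset] image_mset_cong)
  also have "\<dots> = c ^ n * (\<Prod>a\<in>#proots (char_poly M). r (eigen_adj n M a *\<^sub>v u))"
    by (simp add: prod_mset.distrib prod_mset_constant proots_char_poly(2)[OF M])
  finally have prods: "(\<Prod>a\<in>#proots (char_poly M). q (eigen_adj n M a *\<^sub>v u)) =
      c ^ n * (\<Prod>a\<in>#proots (char_poly M). r (eigen_adj n M a *\<^sub>v u))" .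
  have eq1: "eigen_norm n d q (M) =
      (\<Prod>a\<in>#proots (char_poly (M)). q (eigen_adj n (M) a *\<^sub>v u)) / det (krylov_mat n (M) u) ^ d"
    by (rule eigen_norm_eq) (use M q u in auto)
  have eq2: "eigen_norm n d r (M) =
      (\<Prod>a\<in>#proots (char_poly (M)). r (eigen_adj n (M) a *\<^sub>v u)) / det (krylov_mat n (M) u) ^ d"
    by (rule eigen_norm_eq) (use M r u in auto)
  show ?thesis unfolding eq1 eq2 prods by simp
qed

text \<open>
The adjugate is homogeneous of degree \<open>n - 1\<close>, and column \<open>k\<close> of the Krylov matrix is homogeneous of
degree \<open>k\<close>. For \<open>n = d = 4\<close> the norm is therefore homogeneous of degree \<open>48 - 24 = 24\<close>.
\<close>

lemma eigen_norm_smult: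
  fixes M :: "complex mat"
  assumes M: "M \<in> carrier_mat n n" and c: "c \<noteq> 0"
    and q: "\<And>c v. v \<in> carrier_vec n \<Longrightarrow> q (c \<cdot>\<^sub>v v) = c ^ d * q v"
    and u: "u \<in> carrier_vec n" "det (krylov_mat n M u) \<noteq> 0"
  shows "eigen_norm n d q (c \<cdot>\<^sub>m M) * (\<Prod>k<n. c ^ k) ^ d = c ^ ((n - 1) * d * n) * eigen_norm n d q M"
    and "det (krylov_mat n (c \<cdot>\<^sub>m M) u) \<noteq> 0"
proof -
  have cM: "c \<cdot>\<^sub>m M \<in> carrier_mat n n" using M by simp
  have kry: "krylov (c \<cdot>\<^sub>m M) u k = c ^ k \<cdot>\<^sub>v krylov M u k" for k
  proof (induction k)
    case (Suc k)
    have "c \<cdot>\<^sub>m M *\<^sub>v (c ^ k \<cdot>\<^sub>v krylov M u k) = c \<cdot>\<^sub>v (M *\<^sub>v (c ^ k \<cdot>\<^sub>v krylov M u k))"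
      by (rule smult_mat_mult_vec) (use M u in auto)
    also have "\<dots> = c ^ Suc k \<cdot>\<^sub>v krylov M u (Suc k)"
      using M u by (simp add: mult_mat_vec[where nr=n and nc=n] krylov_Suc smult_smult_assoc)
    finally show ?case by (simp add: krylov_Suc Suc)
  qed (use u in auto)
  define D where "D = mat n n (\<lambda>(i,j). if i = j then c ^ i else 0)"
  have D: "D \<in> carrier_mat n n" by (simp add: D_def)
  have "krylov_mat n (c \<cdot>\<^sub>m M) u = krylov_mat n M u * D"
  proof (rule eq_matI)
    fix i j assume "i < dim_row (krylov_mat n M u * D)" "j < dim_col (krylov_mat n M u * D)"
    then have ij: "i < n" "j < n" by (auto simp: D_def krylov_mat_def)
    have "(krylov_mat n M u * D) $$ (i,j) = (\<Sum>k\<in>{0..<n}. krylov M u k $ i * (if k = j then c ^ k else 0))"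
      using ij by (simp add: D_def krylov_mat_def scalar_prod_def)
    also have "\<dots> = (\<Sum>k\<in>{0..<n}. if k = j then krylov M u k $ i * c ^ k else 0)"
      by (rule sum.cong) auto
    also have "\<dots> = krylov M u j $ i * c ^ j" using ij by simp
    finally show "krylov_mat n (c \<cdot>\<^sub>m M) u $$ (i,j) = (krylov_mat n M u * D) $$ (i,j)"
      using ij M u by (simp add: krylov_mat_def kry)
  qed (auto simp: krylov_mat_def D_def)
  moreover have "det D = (\<Prod>k<n. c ^ k)"
    by (subst det_upper_triangular[OF _ D])
      (auto simp: D_def upper_triangular_def diag_mat_def prod.list_conv_set_nth atLeast0LessThan)
  ultimately have detK: "det (krylov_mat n (c \<cdot>\<^sub>m M) u) = (\<Prod>k<n. c ^ k) * det (krylov_mat n M u)"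
    by (simp add: det_mult[where n=n] D)
  then show K0: "det (krylov_mat n (c \<cdot>\<^sub>m M) u) \<noteq> 0" using u c by simp
  obtain as where as: "char_poly M = (\<Prod>a\<leftarrow>as. [:- a, 1:])" "length as = n"
    using char_poly_factorized[OF M] by blast
  have "poly (char_poly (c \<cdot>\<^sub>m M)) x = poly (\<Prod>a\<leftarrow>map ((*) c) as. [:- a, 1:]) x" for x
  proof -
    have "x \<cdot>\<^sub>m 1\<^sub>m n - c \<cdot>\<^sub>m M = c \<cdot>\<^sub>m ((x / c) \<cdot>\<^sub>m 1\<^sub>m n - M)"
      using M c by (intro eq_matI) (auto simp: field_simps)
    then have "poly (char_poly (c \<cdot>\<^sub>m M)) x = c ^ n * poly (char_poly M) (x / c)"
      using M by (simp add: char_poly_eq_det[OF cM] char_poly_eq_det[OF M])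
    also have "\<dots> = c ^ length as * (\<Prod>a\<leftarrow>as. x / c - a)"
      by (simp add: as poly_prod_list o_def)
    also have "\<dots> = (\<Prod>a\<leftarrow>as. x - c * a)"
      using c by (induction as) (auto simp: field_simps)
    finally show ?thesis by (simp add: poly_prod_list o_def)
  qed
  then have cas: "char_poly (c \<cdot>\<^sub>m M) = (\<Prod>a\<leftarrow>map ((*) c) as. [:- a, 1:])"
    by (simp add: poly_eq_poly_eq_iff[symmetric] fun_eq_iff)
  have adj: "eigen_adj n (c \<cdot>\<^sub>m M) (c * a) = c ^ (n - 1) \<cdot>\<^sub>m eigen_adj n M a" for a
  proof -
    let ?N = "a \<cdot>\<^sub>m 1\<^sub>m n - M"
    have N: "?N \<in> carrier_mat n n" using M by (simp add: minus_carrier_mat)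
    have eq: "(c * a) \<cdot>\<^sub>m 1\<^sub>m n - c \<cdot>\<^sub>m M = c \<cdot>\<^sub>m ?N"
      using M by (intro eq_matI) (auto simp: field_simps)
    have "mat_delete (c \<cdot>\<^sub>m ?N) i j = c \<cdot>\<^sub>m mat_delete ?N i j" if "i < n" "j < n" for i j
      using M that by (intro eq_matI) (auto simp: mat_delete_def)
    then have "cofactor (c \<cdot>\<^sub>m ?N) i j = c ^ (n - 1) * cofactor ?N i j" if "i < n" "j < n" for i j
      using that M by (simp add: cofactor_def)
    then show ?thesis
      unfolding eigen_adj_def eq using M by (intro eq_matI) (auto simp: adj_mat_def)
  qed
  have "(\<Prod>a\<in>#proots (char_poly (c \<cdot>\<^sub>m M)). q (eigen_adj n (c \<cdot>\<^sub>m M) a *\<^sub>v u)) =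
      (\<Prod>a\<leftarrow>as. q (eigen_adj n (c \<cdot>\<^sub>m M) (c * a) *\<^sub>v u))"
    by (simp add: prod_char_roots[OF cas] o_def)
  also have "\<dots> = (\<Prod>a\<leftarrow>as. c ^ ((n - 1) * d) * q (eigen_adj n M a *\<^sub>v u))"
  proof -
    have "eigen_adj n (c \<cdot>\<^sub>m M) (c * a) *\<^sub>v u = c ^ (n - 1) \<cdot>\<^sub>v (eigen_adj n M a *\<^sub>v u)" for a
      unfolding adj by (rule smult_mat_mult_vec) (use M u in auto)
    then show ?thesis using M u by (simp add: q power_mult mult_mat_vec_carrier[where n=n])
  qed
  also have "\<dots> = c ^ ((n - 1) * d * n) * (\<Prod>a\<in>#proots (char_poly M). q (eigen_adj n M a *\<^sub>v u))"
    by (simp add: prod_list_map_mult map_replicate_const as(2) prod_char_roots[OF as(1)] power_mult)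
  finally have prods: "(\<Prod>a\<in>#proots (char_poly (c \<cdot>\<^sub>m M)). q (eigen_adj n (c \<cdot>\<^sub>m M) a *\<^sub>v u)) =
      c ^ ((n - 1) * d * n) * (\<Prod>a\<in>#proots (char_poly M). q (eigen_adj n M a *\<^sub>v u))" .
  have eq1: "eigen_norm n d q (M) =
      (\<Prod>a\<in>#proots (char_poly (M)). q (eigen_adj n (M) a *\<^sub>v u)) / det (krylov_mat n (M) u) ^ d"
    by (rule eigen_norm_eq) (use M q u in auto)
  have eq2: "eigen_norm n d q (c \<cdot>\<^sub>m M) =
      (\<Prod>a\<in>#proots (char_poly (c \<cdot>\<^sub>m M)). q (eigen_adj n (c \<cdot>\<^sub>m M) a *\<^sub>v u)) / det (krylov_mat n (c \<cdot>\<^sub>m M) u) ^ d"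
    by (rule eigen_norm_eq) (use cM q u K0 in auto)
  show "eigen_norm n d q (c \<cdot>\<^sub>m M) * (\<Prod>k<n. c ^ k) ^ d = c ^ ((n - 1) * d * n) * eigen_norm n d q M"
    unfolding eq1 eq2 prods using c by (simp add: detK power_mult_distrib)
qed

section \<open>A zero of the form on the eigenvectors of a pencil\<close>

lemma eigen_iff_kernel:
  fixes M :: "'a :: field mat"
  assumes M: "M \<in> carrier_mat n n" and v: "v \<in> carrier_vec n"
  shows "(a \<cdot>\<^sub>m 1\<^sub>m n - M) *\<^sub>v v = 0\<^sub>v n \<longleftrightarrow> M *\<^sub>v v = a \<cdot>\<^sub>v v"
proof -
  have "transpose_mat (a \<cdot>\<^sub>m 1\<^sub>m n - transpose_mat M) = a \<cdot>\<^sub>m 1\<^sub>m n - M"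
    using M by (auto intro!: eq_matI)
  then show ?thesis using transpose_eigen_iff[of "transpose_mat M" n v a] M v by simp
qed

text \<open>
Without a cyclic vector some eigenspace contains two independent vectors \<open>w1, w2\<close>. On
\<open>w1 + t w2\<close> the form is a polynomial \<open>h\<close> in one variable whose leading coefficient is the value of the form at \<open>w2\<close>, hence not zero; so
\<open>h\<close> has degree four and a root.
\<close>

lemma cyclic_vector_if_no_eigenvector_zero:
  assumes M: "M \<in> carrier_mat 4 4" and C: "C \<in> carrier_mat 4 4" and D: "D \<in> carrier_mat 4 4"
    and nz: "\<And>v a. v \<in> carrier_vec 4 \<Longrightarrow> v \<noteq> 0\<^sub>v 4 \<Longrightarrow> M *\<^sub>v v = a \<cdot>\<^sub>v v \<Longrightarrow> flag_form C D v \<noteq> 0"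
  shows "\<exists>u\<in>carrier_vec 4. det (krylov_mat 4 M u) \<noteq> 0"
  using M
proof (cases rule: cyclic_vector_or_left_eigenspace_dim_two)
  case (cyclic u)
  then show ?thesis by blast
next
  case (eigenspace a \<phi> \<psi>)
  have N: "a \<cdot>\<^sub>m 1\<^sub>m 4 - M \<in> carrier_mat 4 4" using M by (simp add: minus_carrier_mat)
  have ker: "\<exists>w\<in>carrier_vec 4. w \<noteq> 0\<^sub>v 4 \<and> M *\<^sub>v w = a \<cdot>\<^sub>v w \<and> l \<bullet> w = 0" if "l \<in> carrier_vec 4" for l
    using left_kernel_dim_two_imp_kernel_dim_two[OF N that, of \<phi> \<psi>] eigenspace
      transpose_eigen_iff[OF M] eigen_iff_kernel[OF M] by metis
  obtain w1 where w1: "w1 \<in> carrier_vec 4" "w1 \<noteq> 0\<^sub>v 4" "M *\<^sub>v w1 = a \<cdot>\<^sub>v w1"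
    using ker[of "0\<^sub>v 4"] by auto
  obtain i where i: "i < 4" "w1 $ i \<noteq> 0"
    using w1(1,2) by (metis carrier_vecD eq_vecI index_zero_vec(1) index_zero_vec(2))
  obtain w2 where w2: "w2 \<in> carrier_vec 4" "w2 \<noteq> 0\<^sub>v 4" "M *\<^sub>v w2 = a \<cdot>\<^sub>v w2" "w2 $ i = 0"
    using ker[of "unit_vec 4 i"] i by auto
  \<comment> \<open>\<open>k\<close> is \<open>h\<close> in the coordinate \<open>1 / t\<close> around the direction of \<open>w2\<close>.\<close>
  define h where "h t = flag_form C D (w1 + t \<cdot>\<^sub>v w2)" for t
  define k where "k s = flag_form C D (s \<cdot>\<^sub>v w1 + w2)" for s
  have "h holomorphic_on UNIV"
    unfolding h_def using w1(1) w2(1)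
    by (intro holo.flag_form C D) (auto simp: holo.vec_family_def intro!: holomorphic_intros)
  moreover have "k holomorphic_on UNIV"
    unfolding k_def using w1(1) w2(1)
    by (intro holo.flag_form C D) (auto simp: holo.vec_family_def intro!: holomorphic_intros)
  then have "isCont k 0"
    using holomorphic_on_imp_continuous_on continuous_on_eq_continuous_at by blast
  moreover have "k 0 \<noteq> 0"
  proof -
    have "0 \<cdot>\<^sub>v w1 + w2 = w2" using w1(1) w2(1) by auto
    then show ?thesis using nz[OF w2(1-3)] by (simp add: k_def)
  qed
  moreover have "h t = t ^ 4 * k (1 / t)" if "t \<noteq> 0" for t
  proof -
    have "w1 + t \<cdot>\<^sub>v w2 = t \<cdot>\<^sub>v ((1 / t) \<cdot>\<^sub>v w1 + w2)"
      using that w1(1) w2(1) by (intro eq_vecI) (auto simp: algebra_simps)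
    then show ?thesis unfolding h_def k_def
      using flag_form_smult[OF C D, of "(1 / t) \<cdot>\<^sub>v w1 + w2" t] w1(1) w2(1) by simp
  qed
  ultimately obtain t where t: "h t = 0"
    using entire_pole_at_infinity_has_zero[of h k 4] by auto
  have "(w1 + t \<cdot>\<^sub>v w2) $ i \<noteq> 0" using i w1(1) w2(1,4) by simp
  then have "w1 + t \<cdot>\<^sub>v w2 \<noteq> 0\<^sub>v 4" using i by auto
  moreover have "M *\<^sub>v (w1 + t \<cdot>\<^sub>v w2) = a \<cdot>\<^sub>v (w1 + t \<cdot>\<^sub>v w2)"
    using w1 w2 M by (subst mult_add_distrib_mat_vec[where nr=4 and nc=4])
      (auto simp: mult_mat_vec[where nr=4 and nc=4] algebra_simps intro!: eq_vecI)
  ultimately have "h t \<noteq> 0" unfolding h_def using nz w1(1) w2(1) by simp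
  then show ?thesis using t by simp
qed

text \<open>
Near each point a single cyclic vector \<open>u\<close> can be used, and then the norm is a quotient of entire functions
with nonvanishing denominator.
\<close>

lemma eigen_norm_pencil_holomorphic:
  assumes X: "X \<in> carrier_mat 4 4" and Y: "Y \<in> carrier_mat 4 4"
    and C: "C \<in> carrier_mat 4 4" and D: "D \<in> carrier_mat 4 4"
    and cyc: "\<And>y. \<exists>u\<in>carrier_vec 4. det (krylov_mat 4 (X + y \<cdot>\<^sub>m Y) u) \<noteq> 0"
  shows "(\<lambda>y. eigen_norm 4 4 (flag_form C D) (X + y \<cdot>\<^sub>m Y)) holomorphic_on UNIV"
proof -
  define M where "M y = X + y \<cdot>\<^sub>m Y" for y
  have M: "M y \<in> carrier_mat 4 4" for y using X Y by (simp add: M_def)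
  have famM: "holo.mat_family 4 M"
    using M X Y by (auto simp: holo.mat_family_def M_def intro!: holomorphic_intros)
  have "(\<lambda>y. eigen_norm 4 4 (flag_form C D) (M y)) field_differentiable at y0" for y0
  proof -
    obtain u where u: "u \<in> carrier_vec 4" "det (krylov_mat 4 (M y0) u) \<noteq> 0"
      using cyc[of y0] by (auto simp: M_def)
    define K where "K y = det (krylov_mat 4 (M y) u)" for y
    define R where "R y = (\<Prod>a\<in>#proots (char_poly (M y)). flag_form C D (eigen_adj 4 (M y) a *\<^sub>v u))" for y
    have K: "K holomorphic_on UNIV"
      unfolding K_def krylov_mat_def
      using holo.vec_family_krylov[OF famM holo.vec_family_const[OF u(1)]]
      by (intro holo.det[where n=4] holo.mat_family_mat[where f = "\<lambda>y i j. krylov (M y) u j $ i"])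
        (auto simp: holo.vec_family_def)
    have "pfam.mat_family 4 (\<lambda>x. snd x \<cdot>\<^sub>m 1\<^sub>m 4 - M (fst x))"
    proof -
      have "poly_family (\<lambda>x. (snd x \<cdot>\<^sub>m 1\<^sub>m 4 - M (fst x)) $$ (i, j))" if ij: "i < 4" "j < 4" for i j
      proof -
        have "poly_family (\<lambda>x. M (fst x) $$ (i,j))"
          by (rule poly_family_fst) (use famM ij in \<open>auto simp: holo.mat_family_def\<close>)
        then have "poly_family (\<lambda>x. snd x * (if i = j then 1 else 0) - M (fst x) $$ (i,j))"
          by (intro pfam.diff pfam.mult poly_family_snd pfam.const)
        moreover have "(snd x \<cdot>\<^sub>m 1\<^sub>m 4 - M (fst x)) $$ (i, j) =
            snd x * (if i = j then 1 else 0) - M (fst x) $$ (i,j)" for x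
          using ij M[of "fst x"] by (cases x) auto
        ultimately show ?thesis by simp
      qed
      then show ?thesis using M by (auto simp: pfam.mat_family_def minus_carrier_mat)
    qed
    then have "pfam.vec_family 4 (\<lambda>x. eigen_adj 4 (M (fst x)) (snd x) *\<^sub>v u)"
      unfolding eigen_adj_def by (intro pfam.vec_family_mult pfam.mat_family_adj pfam.vec_family_const u(1))
    then have "poly_family (\<lambda>x. flag_form C D (eigen_adj 4 (M (fst x)) (snd x) *\<^sub>v u))"
      by (rule pfam.flag_form[OF C D])
    from prod_eigenvalues_holomorphic[OF famM this] have R: "R holomorphic_on UNIV"
      by (simp add: R_def[abs_def])
    have "open {y. K y \<noteq> 0}"
      using holomorphic_on_imp_continuous_on[OF K]
      by (intro open_Collect_neq) auto
    moreover have "(\<lambda>y. eigen_norm 4 4 (flag_form C D) (M y)) holomorphic_on {y. K y \<noteq> 0}"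
    proof (rule holomorphic_transform[of "\<lambda>y. R y / K y ^ 4"])
      show "(\<lambda>y. R y / K y ^ 4) holomorphic_on {y. K y \<noteq> 0}"
        by (intro holomorphic_intros holomorphic_on_subset[OF R] holomorphic_on_subset[OF K]) auto
      show "R y / K y ^ 4 = eigen_norm 4 4 (flag_form C D) (M y)" if "y \<in> {y. K y \<noteq> 0}" for y
        unfolding R_def K_def
        by (rule eigen_norm_eq[symmetric])
          (use that M u(1) in \<open>auto simp: K_def flag_form_smult[OF C D]\<close>)
    qed
    ultimately show ?thesis
      using u(2) by (auto simp: K_def intro: holomorphic_on_imp_differentiable_at)
  qed
  then show ?thesis by (simp add: holomorphic_on_def M_def)
qed

text \<open>
Suppose that there is no zero. The norm \<open>F\<close> of the form along \<open>B + y A\<close> compares with the norm \<open>k\<close> of the exchanged form along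
\<open>A + z B\<close>, \<open>z = 1/y\<close>: homogeneity contributes \<open>y\<^bsup>24\<^esup>\<close>, and \<open>flag_form_swap\<close> contributes \<open>z\<^sup>3\<close> for each of
the four eigenvectors. The surplus \<open>y\<^bsup>12\<^esup>\<close> is the pole at infinity that an entire function without
zeros cannot have.
\<close>

lemma form_zero_on_pencil_eigenvector:
  assumes A: "A \<in> carrier_mat 4 4" and B: "B \<in> carrier_mat 4 4"
  shows "\<exists>v\<in>carrier_vec 4. v \<noteq> 0\<^sub>v 4 \<and> (\<exists>y a.
    (B + y \<cdot>\<^sub>m A) *\<^sub>v v = a \<cdot>\<^sub>v v \<and> flag_form A B v = 0 \<or>
    (A + y \<cdot>\<^sub>m B) *\<^sub>v v = a \<cdot>\<^sub>v v \<and> flag_form B A v = 0)"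
proof (rule ccontr)
  assume no: "\<not> ?thesis"
  have nzA: "flag_form A B v \<noteq> 0"
    if "v \<in> carrier_vec 4" "v \<noteq> 0\<^sub>v 4" "(B + y \<cdot>\<^sub>m A) *\<^sub>v v = a \<cdot>\<^sub>v v" for v y a
    using no that by blast
  have nzB: "flag_form B A v \<noteq> 0"
    if "v \<in> carrier_vec 4" "v \<noteq> 0\<^sub>v 4" "(A + y \<cdot>\<^sub>m B) *\<^sub>v v = a \<cdot>\<^sub>v v" for v y a
    using no that by blast
  have BA: "B + y \<cdot>\<^sub>m A \<in> carrier_mat 4 4" and AB: "A + y \<cdot>\<^sub>m B \<in> carrier_mat 4 4" for y
    using A B by auto
  have cycA: "\<exists>u\<in>carrier_vec 4. det (krylov_mat 4 (B + y \<cdot>\<^sub>m A) u) \<noteq> 0" for y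
    by (rule cyclic_vector_if_no_eigenvector_zero[OF BA A B nzA])
  have cycB: "\<exists>u\<in>carrier_vec 4. det (krylov_mat 4 (A + y \<cdot>\<^sub>m B) u) \<noteq> 0" for y
    by (rule cyclic_vector_if_no_eigenvector_zero[OF AB B A nzB])
  define F where "F y = eigen_norm 4 4 (flag_form A B) (B + y \<cdot>\<^sub>m A)" for y
  define k where "k z = eigen_norm 4 4 (flag_form B A) (A + z \<cdot>\<^sub>m B)" for z
  have F0: "F y \<noteq> 0" for y
  proof -
    obtain u where "u \<in> carrier_vec 4" "det (krylov_mat 4 (B + y \<cdot>\<^sub>m A) u) \<noteq> 0" using cycA by blast
    then show ?thesis unfolding F_def
      using eigen_norm_nonzero[OF BA flag_form_smult[OF A B]] nzA by blast
  qed
  have k0: "k z \<noteq> 0" for z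
  proof -
    obtain u where "u \<in> carrier_vec 4" "det (krylov_mat 4 (A + z \<cdot>\<^sub>m B) u) \<noteq> 0" using cycB by blast
    then show ?thesis unfolding k_def
      using eigen_norm_nonzero[OF AB flag_form_smult[OF B A]] nzB by blast
  qed
  have "F y = y ^ 12 * k (1 / y)" if y: "y \<noteq> 0" for y
  proof -
    let ?M = "A + (1 / y) \<cdot>\<^sub>m B"
    have scale: "B + y \<cdot>\<^sub>m A = y \<cdot>\<^sub>m ?M" using A B y by (intro eq_matI) (auto simp: algebra_simps)
    obtain u where u: "u \<in> carrier_vec 4" "det (krylov_mat 4 ?M u) \<noteq> 0" using cycB by blast
    have "F y * (\<Prod>k<4. y ^ k) ^ 4 = y ^ ((4 - 1) * 4 * 4) * eigen_norm 4 4 (flag_form A B) ?M"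
      unfolding F_def scale
      by (rule eigen_norm_smult(1)[OF AB y flag_form_smult[OF A B] u])
    moreover have "(\<Prod>k<4. y ^ k) = y ^ 6"
      by (simp add: numeral_eq_Suc)
    moreover have "eigen_norm 4 4 (flag_form A B) ?M = ((1 / y) ^ 3) ^ 4 * k (1 / y)"
      unfolding k_def
      by (rule eigen_norm_cong[OF AB flag_form_smult[OF A B] flag_form_smult[OF B A] u])
        (auto intro: flag_form_swap[OF A B])
    ultimately have "F y * y ^ 24 = y ^ 48 * ((1 / y) ^ 12 * k (1 / y))"
      by (simp flip: power_mult)
    moreover have "y ^ 48 = y ^ 12 * (y ^ 24 * y ^ 12)" by (simp flip: power_add)
    moreover have "y ^ 12 * ((1 / y) ^ 12 * k (1 / y)) = k (1 / y)"
      using y by (simp add: power_one_over)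
    ultimately have "F y * y ^ 24 = (y ^ 12 * k (1 / y)) * y ^ 24"
      by (simp only: mult.assoc) (simp only: mult_ac)
    then show ?thesis using y by simp
  qed
  moreover have "F holomorphic_on UNIV"
    unfolding F_def by (rule eigen_norm_pencil_holomorphic[OF B A A B cycA])
  moreover have "k holomorphic_on UNIV"
    unfolding k_def by (rule eigen_norm_pencil_holomorphic[OF A B B A cycB])
  then have "isCont k 0"
    using holomorphic_on_imp_continuous_on continuous_on_eq_continuous_at by blast
  ultimately show False
    using entire_pole_at_infinity_has_zero[of F k 12] k0 F0 by auto
qed

section \<open>Orthonormal bases and unitary conjugation\<close>

lemma scalar_prod_conjugate_commute:
  fixes x y :: "complex vec"
  assumes "x \<in> carrier_vec n" "y \<in> carrier_vec n"
  shows "y \<bullet>c x = cnj (x \<bullet>c y)"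
  using assms by (simp add: scalar_prod_def mult.commute)

lemma exists_unit_multiple:
  fixes x :: "complex vec"
  assumes x: "x \<in> carrier_vec n" "x \<noteq> 0\<^sub>v n"
  obtains c where "c \<noteq> 0" "(c \<cdot>\<^sub>v x) \<bullet>c (c \<cdot>\<^sub>v x) = 1"
proof
  define s where "s = (\<Sum>i\<in>{0..<n}. (cmod (x $ i))\<^sup>2)"
  obtain i where i: "i < n" "x $ i \<noteq> 0"
    using x by (metis carrier_vecD eq_vecI index_zero_vec(1) index_zero_vec(2))
  have "0 < (cmod (x $ i))\<^sup>2" using i by simp
  also have "\<dots> \<le> s" unfolding s_def using i by (intro member_le_sum) auto
  finally have s: "s > 0" .
  have xx: "x \<bullet>c x = complex_of_real s"
    unfolding s_def of_real_sum complex_norm_square using x(1) by (simp add: scalar_prod_def)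
  show "complex_of_real (1 / sqrt s) \<noteq> 0" using s by simp
  have "(complex_of_real (1 / sqrt s) \<cdot>\<^sub>v x) \<bullet>c (complex_of_real (1 / sqrt s) \<cdot>\<^sub>v x) =
      complex_of_real (1 / sqrt s) * complex_of_real (1 / sqrt s) * (x \<bullet>c x)"
    using x(1) by (simp add: conjugate_smult_vec)
  also have "\<dots> = complex_of_real (1 / sqrt s * (1 / sqrt s) * s)" unfolding xx by (simp only: of_real_mult)
  also have "1 / sqrt s * (1 / sqrt s) * s = 1" using s by (simp add: field_simps)
  finally show "(complex_of_real (1 / sqrt s) \<cdot>\<^sub>v x) \<bullet>c (complex_of_real (1 / sqrt s) \<cdot>\<^sub>v x) = 1" by simp
qed

text \<open>
Fewer than \<open>n\<close> vectors, padded with zero rows, form a singular matrix; the conjugate of a kernel vector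
is orthogonal to all of them.
\<close>

lemma exists_unit_orthogonal:
  assumes len: "length vs < n" and vs: "set vs \<subseteq> carrier_vec n"
  obtains x :: "complex vec" where "x \<in> carrier_vec n" "x \<bullet>c x = 1" "\<And>v. v \<in> set vs \<Longrightarrow> v \<bullet>c x = 0"
proof -
  define R where "R = mat n n (\<lambda>(i,j). if i < length vs then vs ! i $ j else 0)"
  have R: "R \<in> carrier_mat n n" by (simp add: R_def)
  have "transpose_mat R *\<^sub>v unit_vec n (n - 1) = 0\<^sub>v n"
    using len by (intro eq_vecI) (auto simp: R_def)
  then have "det R = 0"
    unfolding det_zero_iff_left_kernel[OF R] by (intro bexI[of _ "unit_vec n (n - 1)"]) (use len in auto)
  then obtain w where w: "w \<in> carrier_vec n" "w \<noteq> 0\<^sub>v n" "R *\<^sub>v w = 0\<^sub>v n"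
    using det_0_iff_vec_prod_zero[OF R] by blast
  have orth: "v \<bullet> w = 0" if "v \<in> set vs" for v
  proof -
    obtain i where i: "i < length vs" "v = vs ! i" using \<open>v \<in> set vs\<close> by (metis in_set_conv_nth)
    have "v \<bullet> w = (R *\<^sub>v w) $ i" using i w(1) len by (simp add: R_def scalar_prod_def)
    then show ?thesis using w(3) i len by simp
  qed
  have cw: "conjugate w \<in> carrier_vec n" "conjugate w \<noteq> 0\<^sub>v n" using w by auto
  then obtain c where c: "c \<noteq> 0" "(c \<cdot>\<^sub>v conjugate w) \<bullet>c (c \<cdot>\<^sub>v conjugate w) = 1"
    by (rule exists_unit_multiple)
  show thesis
  proof
    show "v \<bullet>c (c \<cdot>\<^sub>v conjugate w) = 0" if "v \<in> set vs" for v
      using orth[OF that] that vs w(1) by (auto simp: conjugate_smult_vec)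
  qed (use c cw in auto)
qed

definition orthonormal :: "nat \<Rightarrow> (nat \<Rightarrow> complex vec) \<Rightarrow> bool" where
  "orthonormal n e \<longleftrightarrow> (\<forall>i<n. e i \<in> carrier_vec n) \<and>
     (\<forall>i<n. \<forall>j<n. e i \<bullet>c e j = (if i = j then 1 else 0))"

lemma orthonormalI:
  assumes "\<And>i. i < n \<Longrightarrow> e i \<in> carrier_vec n" "\<And>i. i < n \<Longrightarrow> e i \<bullet>c e i = 1"
    "\<And>i j. i < j \<Longrightarrow> j < n \<Longrightarrow> e i \<bullet>c e j = 0"
  shows "orthonormal n e"
proof -
  have "e i \<bullet>c e j = 0" if "i < n" "j < n" "i \<noteq> j" for i j
  proof (cases "i < j")
    case False
    then have "e j \<bullet>c e i = 0" using assms(3) that by simp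
    then show ?thesis
      using scalar_prod_conjugate_commute[of "e j" n "e i"] assms(1) that by simp
  qed (use assms that in simp)
  then show ?thesis using assms(1,2) by (simp add: orthonormal_def)
qed

lemma mat_adjoint_carrier:
  "A \<in> carrier_mat n m \<Longrightarrow> mat_adjoint A \<in> carrier_mat m n"
  by (rule carrier_matI) (simp_all add: mat_adjoint_def)

text \<open>
The rows of \<open>U\<close> are the conjugates of the basis vectors, so that \<open>U A U\<^sup>*\<close> is the matrix of \<open>A\<close> in the basis.
\<close>

lemma tridiagonal_if_orthonormal:
  assumes A: "A \<in> carrier_mat n n" and e: "orthonormal n e"
    and tri: "\<And>i j. i < n \<Longrightarrow> j < n \<Longrightarrow> \<bar>int i - int j\<bar> \<ge> 2 \<Longrightarrow> (A *\<^sub>v e j) \<bullet>c e i = 0"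
  shows "\<exists>U\<in>unitary_mats n. tridiagonal (U * A * mat_adjoint U)"
proof
  define U where "U = mat n n (\<lambda>(i,j). cnj (e i $ j))"
  have U: "U \<in> carrier_mat n n" by (simp add: U_def)
  have aU: "mat_adjoint U \<in> carrier_mat n n" using U by (rule mat_adjoint_carrier)
  have ec: "e i \<in> carrier_vec n" if "i < n" for i using e that by (simp add: orthonormal_def)
  have col: "col (mat_adjoint U) j = e j" if "j < n" for j
  proof (rule eq_vecI)
    fix i assume "i < dim_vec (e j)"
    then have i: "i < n" using ec[OF that] by simp
    have "mat_adjoint U $$ (i, j) = cnj (U $$ (j, i))" by (rule index_mat_adjoint_complex[OF U i that])
    also have "\<dots> = e j $ i" using i that by (simp add: U_def)
    finally show "col (mat_adjoint U) j $ i = e j $ i" using i that aU by simp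
  qed (use aU ec[OF that] in auto)
  have row: "row U i = conjugate (e i)" if "i < n" for i
    using that ec[OF that] by (intro eq_vecI) (auto simp: U_def)
  have "U * mat_adjoint U = 1\<^sub>m n"
  proof (rule eq_matI)
    fix i j assume "i < dim_row (1\<^sub>m n :: complex mat)" "j < dim_col (1\<^sub>m n :: complex mat)"
    then have ij: "i < n" "j < n" by auto
    have "conjugate (e i) \<bullet> e j = e j \<bullet>c e i"
      using ec ij by (intro comm_scalar_prod[of _ n]) auto
    then show "(U * mat_adjoint U) $$ (i,j) = 1\<^sub>m n $$ (i,j)"
      using ij U aU e by (simp add: row col orthonormal_def)
  qed (use U aU in auto)
  moreover from this have "mat_adjoint U * U = 1\<^sub>m n" by (rule mat_mult_left_right_inverse[OF U aU])
  ultimately show "U \<in> unitary_mats n" using U by (simp add: unitary_mats_def)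
  show "tridiagonal (U * A * mat_adjoint U)"
    unfolding tridiagonal_def
  proof (intro allI impI)
    fix i j assume "i < dim_row (U * A * mat_adjoint U)" "j < dim_col (U * A * mat_adjoint U)"
      and far: "2 \<le> \<bar>int i - int j\<bar>"
    then have ij: "i < n" "j < n" using U aU by auto
    have "U * A * mat_adjoint U = U * (A * mat_adjoint U)" by (rule assoc_mult_mat[OF U A aU])
    then have "(U * A * mat_adjoint U) $$ (i,j) = row U i \<bullet> col (A * mat_adjoint U) j"
      using ij U aU A by simp
    also have "col (A * mat_adjoint U) j = A *\<^sub>v e j" using col_mult2[OF A aU ij(2)] col ij by simp
    also have "row U i \<bullet> (A *\<^sub>v e j) = (A *\<^sub>v e j) \<bullet>c e i"
      unfolding row[OF ij(1)] using A ec ij by (intro comm_scalar_prod[of _ n]) (auto intro!: mult_mat_vec_carrier[where n=n])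
    also have "\<dots> = 0" by (rule tri[OF ij far])
    finally show "(U * A * mat_adjoint U) $$ (i, j) = 0" .
  qed
qed

text \<open>
A relation that is symmetric in \<open>A\<close> and \<open>B\<close>, so that their roles can be exchanged, as the two cases of
\<open>form_zero_on_pencil_eigenvector\<close> require.
\<close>

definition adjoint_pair :: "nat \<Rightarrow> complex mat \<Rightarrow> complex mat \<Rightarrow> bool" where
  "adjoint_pair n A B \<longleftrightarrow> A \<in> carrier_mat n n \<and> B \<in> carrier_mat n n \<and>
     (\<forall>x\<in>carrier_vec n. \<forall>y\<in>carrier_vec n. (A *\<^sub>v x) \<bullet>c y = x \<bullet>c (B *\<^sub>v y))"

lemma adjoint_pair_adjoint:
  assumes A: "A \<in> carrier_mat n n"
  shows "adjoint_pair n A (mat_adjoint A)"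
proof -
  have aA: "mat_adjoint A \<in> carrier_mat n n" using A by (rule mat_adjoint_carrier)
  have "(A *\<^sub>v x) \<bullet>c y = x \<bullet>c (mat_adjoint A *\<^sub>v y)" if x: "x \<in> carrier_vec n" and y: "y \<in> carrier_vec n" for x y
  proof -
    have "(A *\<^sub>v x) \<bullet>c y = (\<Sum>i\<in>{0..<n}. (\<Sum>j\<in>{0..<n}. A $$ (i,j) * x $ j) * cnj (y $ i))"
      using A x y by (simp add: scalar_prod_def)
    also have "\<dots> = (\<Sum>j\<in>{0..<n}. \<Sum>i\<in>{0..<n}. A $$ (i,j) * x $ j * cnj (y $ i))"
      unfolding sum_distrib_right by (rule sum.swap)
    also have "\<dots> = (\<Sum>j\<in>{0..<n}. x $ j * cnj (\<Sum>i\<in>{0..<n}. mat_adjoint A $$ (j,i) * y $ i))"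
      by (simp add: index_mat_adjoint_complex[OF A] sum_distrib_left mult_ac)
    also have "\<dots> = x \<bullet>c (mat_adjoint A *\<^sub>v y)"
      using aA x y by (simp add: scalar_prod_def)
    finally show ?thesis .
  qed
  then show ?thesis using A aA by (simp add: adjoint_pair_def)
qed

lemma adjoint_pair_commute:
  assumes "adjoint_pair n A B"
  shows "adjoint_pair n B A"
proof -
  have "(B *\<^sub>v x) \<bullet>c y = x \<bullet>c (A *\<^sub>v y)" if x: "x \<in> carrier_vec n" and y: "y \<in> carrier_vec n" for x y
  proof -
    have car: "A *\<^sub>v y \<in> carrier_vec n" "B *\<^sub>v x \<in> carrier_vec n"
      using assms x y by (auto simp: adjoint_pair_def intro!: mult_mat_vec_carrier[where n=n])
    have "(B *\<^sub>v x) \<bullet>c y = cnj (y \<bullet>c (B *\<^sub>v x))" by (rule scalar_prod_conjugate_commute[OF y car(2)])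
    also have "y \<bullet>c (B *\<^sub>v x) = (A *\<^sub>v y) \<bullet>c x" using assms x y by (simp add: adjoint_pair_def)
    also have "cnj \<dots> = x \<bullet>c (A *\<^sub>v y)" by (rule scalar_prod_conjugate_commute[OF car(1) x, symmetric])
    finally show ?thesis .
  qed
  then show ?thesis using assms by (simp add: adjoint_pair_def)
qed

lemma adjoint_pair_entry:
  assumes "adjoint_pair n A B" "x \<in> carrier_vec n" "y \<in> carrier_vec n" "(B *\<^sub>v y) \<bullet>c x = 0"
  shows "(A *\<^sub>v x) \<bullet>c y = 0"
proof -
  have "(A *\<^sub>v x) \<bullet>c y = x \<bullet>c (B *\<^sub>v y)" using assms by (simp add: adjoint_pair_def)
  also have "\<dots> = cnj ((B *\<^sub>v y) \<bullet>c x)"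
    using assms by (intro scalar_prod_conjugate_commute) (auto simp: adjoint_pair_def intro!: mult_mat_vec_carrier[where n=n])
  finally show ?thesis using assms by simp
qed

section \<open>Tridiagonal form in dimension at most four\<close>

text \<open>
The conditions on \<open>A\<close> make the entries below the subdiagonal of \<open>A\<close>, written in this basis, vanish; those on
\<open>B = A\<^sup>*\<close> concern the conjugates of the entries above the superdiagonal.
\<close>

definition flag_basis :: "complex mat \<Rightarrow> complex mat \<Rightarrow> complex vec \<Rightarrow> complex vec \<Rightarrow> complex vec \<Rightarrow> complex vec \<Rightarrow> bool" where
  "flag_basis A B e0 e1 e2 e3 \<longleftrightarrow> orthonormal 4 (\<lambda>i. [e0, e1, e2, e3] ! i) \<and>
     (A *\<^sub>v e0) \<bullet>c e2 = 0 \<and> (A *\<^sub>v e0) \<bullet>c e3 = 0 \<and> (A *\<^sub>v e1) \<bullet>c e3 = 0 \<and>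
     (B *\<^sub>v e0) \<bullet>c e2 = 0 \<and> (B *\<^sub>v e0) \<bullet>c e3 = 0 \<and> (B *\<^sub>v e1) \<bullet>c e3 = 0"

lemma orthonormal_4I:
  assumes "e0 \<in> carrier_vec 4" "e1 \<in> carrier_vec 4" "e2 \<in> carrier_vec 4" "e3 \<in> carrier_vec 4"
    and "e0 \<bullet>c e0 = 1" "e1 \<bullet>c e1 = 1" "e2 \<bullet>c e2 = 1" "e3 \<bullet>c e3 = 1"
    and "e0 \<bullet>c e1 = 0" "e0 \<bullet>c e2 = 0" "e0 \<bullet>c e3 = 0" "e1 \<bullet>c e2 = 0" "e1 \<bullet>c e3 = 0" "e2 \<bullet>c e3 = 0"
  shows "orthonormal 4 (\<lambda>i. [e0, e1, e2, e3] ! i)"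
proof (rule orthonormalI)
  fix i j :: nat assume "i < j" "j < 4"
  then have "i = 0 \<and> j = 1 \<or> i = 0 \<and> j = 2 \<or> i = 0 \<and> j = 3 \<or> i = 1 \<and> j = 2 \<or> i = 1 \<and> j = 3 \<or> i = 2 \<and> j = 3"
    by auto
  then show "[e0, e1, e2, e3] ! i \<bullet>c [e0, e1, e2, e3] ! j = 0" using assms by auto
qed (use assms in \<open>auto dest!: less_4_cases\<close>)

lemma tridiagonal_if_flag_basis:
  assumes A: "A \<in> carrier_mat 4 4" and e: "flag_basis A (mat_adjoint A) e0 e1 e2 e3"
  shows "\<exists>U\<in>unitary_mats 4. tridiagonal (U * A * mat_adjoint U)"
proof (rule tridiagonal_if_orthonormal[OF A])
  show on: "orthonormal 4 (\<lambda>i. [e0, e1, e2, e3] ! i)" using e by (simp add: flag_basis_def)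
  fix i j :: nat assume ij: "i < 4" "j < 4" "2 \<le> \<bar>int i - int j\<bar>"
  have car: "e0 \<in> carrier_vec 4" "e1 \<in> carrier_vec 4" "e2 \<in> carrier_vec 4" "e3 \<in> carrier_vec 4"
    using on unfolding orthonormal_def by (auto simp: all_less_4)
  note swap = adjoint_pair_entry[OF adjoint_pair_adjoint[OF A]]
  have "i = 2 \<and> j = 0 \<or> i = 3 \<and> j = 0 \<or> i = 3 \<and> j = 1 \<or> i = 0 \<and> j = 2 \<or> i = 0 \<and> j = 3 \<or> i = 1 \<and> j = 3"
    using ij by auto
  then show "(A *\<^sub>v [e0, e1, e2, e3] ! j) \<bullet>c [e0, e1, e2, e3] ! i = 0"
    using e car by (elim disjE) (auto simp: flag_basis_def intro!: swap)
qed

lemma flag_basis_commute: "flag_basis A B e0 e1 e2 e3 \<Longrightarrow> flag_basis B A e0 e1 e2 e3"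
  by (simp add: flag_basis_def)

text \<open>
Let \<open>e0\<close> be the normalized \<open>v\<close>. If \<open>A e0\<close> is not a multiple of \<open>e0\<close>, then \<open>e1\<close> is its
component orthogonal to \<open>e0\<close>, and \<open>e3\<close> is orthogonal to \<open>e0, A e0, A A e0, B A e0\<close>, which is possible
because the form vanishes. Otherwise \<open>e0\<close> is a common eigenvector of \<open>A\<close> and its adjoint, so that \<open>A\<close>
preserves the orthogonal complement; then \<open>e1\<close> is an eigenvector of \<open>A\<close> there, and \<open>e3\<close> is orthogonal
to \<open>e0, e1, B e1\<close>.
\<close>

lemma flag_basis_if_form_zero:
  assumes AB: "adjoint_pair 4 A B" and v: "v \<in> carrier_vec 4" "v \<noteq> 0\<^sub>v 4"
    and eig: "(B + y \<cdot>\<^sub>m A) *\<^sub>v v = a \<cdot>\<^sub>v v" and zero: "flag_form A B v = 0"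
  shows "\<exists>e0 e1 e2 e3. flag_basis A B e0 e1 e2 e3"
proof -
  have A: "A \<in> carrier_mat 4 4" and B: "B \<in> carrier_mat 4 4" using AB by (auto simp: adjoint_pair_def)
  note car = mult_mat_vec_carrier[OF A] mult_mat_vec_carrier[OF B]
  note lin = add_scalar_prod_distrib[where n=4] smult_scalar_prod_distrib[where n=4]
    minus_scalar_prod_distrib[where n=4]
  obtain c where c: "c \<noteq> 0" "(c \<cdot>\<^sub>v v) \<bullet>c (c \<cdot>\<^sub>v v) = 1" using exists_unit_multiple[OF v] .
  define e0 where "e0 = c \<cdot>\<^sub>v v"
  have e0: "e0 \<in> carrier_vec 4" "e0 \<bullet>c e0 = 1" using v c by (auto simp: e0_def)
  have "(B + y \<cdot>\<^sub>m A) *\<^sub>v e0 = a \<cdot>\<^sub>v e0"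
    unfolding e0_def using eig v A B
    by (auto simp: mult_mat_vec[where nr=4 and nc=4] mult.commute smult_smult_assoc)
  moreover have "(B + y \<cdot>\<^sub>m A) *\<^sub>v e0 = B *\<^sub>v e0 + y \<cdot>\<^sub>v (A *\<^sub>v e0)"
    using A B e0(1) by (simp add: add_mult_distrib_mat_vec[where nr=4 and nc=4] smult_mat_mult_vec[OF A])
  ultimately have eig0: "B *\<^sub>v e0 + y \<cdot>\<^sub>v (A *\<^sub>v e0) = a \<cdot>\<^sub>v e0" by simp
  have Be0: "B *\<^sub>v e0 = a \<cdot>\<^sub>v e0 - y \<cdot>\<^sub>v (A *\<^sub>v e0)"
  proof (rule eq_vecI)
    fix i assume "i < dim_vec (a \<cdot>\<^sub>v e0 - y \<cdot>\<^sub>v (A *\<^sub>v e0))"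
    then have i: "i < 4" using A by simp
    have "(B *\<^sub>v e0 + y \<cdot>\<^sub>v (A *\<^sub>v e0)) $ i = (a \<cdot>\<^sub>v e0) $ i" by (simp only: eig0)
    then show "(B *\<^sub>v e0) $ i = (a \<cdot>\<^sub>v e0 - y \<cdot>\<^sub>v (A *\<^sub>v e0)) $ i"
      using i A B e0(1) by (simp add: algebra_simps del: index_mult_mat_vec)
  qed (use A B in auto)
  define x where "x = A *\<^sub>v e0 - ((A *\<^sub>v e0) \<bullet>c e0) \<cdot>\<^sub>v e0"
  have x: "x \<in> carrier_vec 4" "x \<bullet>c e0 = 0"
    using e0 car by (auto simp: x_def lin)
  have Ae0: "A *\<^sub>v e0 = ((A *\<^sub>v e0) \<bullet>c e0) \<cdot>\<^sub>v e0 + x"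
    using A e0(1) car by (auto simp: x_def intro!: eq_vecI simp del: index_mult_mat_vec)
  \<comment> \<open>It remains to choose \<open>e1\<close>, which spans with \<open>e0\<close> a plane containing \<open>A e0\<close>, and \<open>e3\<close>;
    the eigenvector equation then puts \<open>B e0\<close> into the same plane.\<close>
  have flagI: "\<exists>e0 e1 e2 e3. flag_basis A B e0 e1 e2 e3"
    if e1: "e1 \<in> carrier_vec 4" "e1 \<bullet>c e1 = 1" "e1 \<bullet>c e0 = 0"
      and e3: "e3 \<in> carrier_vec 4" "e3 \<bullet>c e3 = 1" "e0 \<bullet>c e3 = 0" "e1 \<bullet>c e3 = 0"
      and plane: "A *\<^sub>v e0 = r \<cdot>\<^sub>v e0 + s \<cdot>\<^sub>v e1" 
      and A1: "(A *\<^sub>v e1) \<bullet>c e3 = 0" and B1: "(B *\<^sub>v e1) \<bullet>c e3 = 0" for e1 e3 r s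
  proof -
    obtain e2 where e2: "e2 \<in> carrier_vec 4" "e2 \<bullet>c e2 = 1" "\<And>v. v \<in> set [e0, e1, e3] \<Longrightarrow> v \<bullet>c e2 = 0"
      using exists_unit_orthogonal[of "[e0, e1, e3]" 4] e0 e1 e3 by auto
    have A0: "(A *\<^sub>v e0) \<bullet>c z = 0" if "z \<in> carrier_vec 4" "e0 \<bullet>c z = 0" "e1 \<bullet>c z = 0" for z
      unfolding plane using that e0 e1 by (simp add: lin)
    have B0: "(B *\<^sub>v e0) \<bullet>c z = 0" if "z \<in> carrier_vec 4" "e0 \<bullet>c z = 0" "e1 \<bullet>c z = 0" for z
      unfolding Be0 using that e0 e1 A0[OF that] car by (simp add: lin)
    have "e0 \<bullet>c e1 = 0" "e2 \<bullet>c e3 = 0"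
      using scalar_prod_conjugate_commute[OF e1(1) e0(1)] scalar_prod_conjugate_commute[OF e3(1) e2(1)] e1 e2 by auto
    then have "flag_basis A B e0 e1 e2 e3"
      unfolding flag_basis_def using e0 e1 e2 e3 A0 B0 A1 B1 by (auto intro!: orthonormal_4I)
    then show ?thesis by blast
  qed
  show ?thesis
  proof (cases "x = 0\<^sub>v 4")
    case True
    define r where "r = (A *\<^sub>v e0) \<bullet>c e0"
    have Ae: "A *\<^sub>v e0 = r \<cdot>\<^sub>v e0" using Ae0 True e0(1) by (simp add: r_def)
    have Be: "B *\<^sub>v e0 = (a - y * r) \<cdot>\<^sub>v e0"
      unfolding Be0 Ae using e0(1) by (auto simp: algebra_simps intro!: eq_vecI)
    define S where "S = {z \<in> carrier_vec 4. z \<bullet>c e0 = 0}"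
    obtain w where w: "w \<in> carrier_vec 4" "w \<bullet>c w = 1" "\<And>v. v \<in> set [e0] \<Longrightarrow> v \<bullet>c w = 0"
      using exists_unit_orthogonal[of "[e0]" 4] e0 by auto
    have "\<exists>z\<in>S. z \<noteq> 0\<^sub>v 4 \<and> (\<exists>b. A *\<^sub>v z = b \<cdot>\<^sub>v z)"
    proof (rule eigenvector_in_invariant_set[OF A])
      show "w \<in> S" using w scalar_prod_conjugate_commute[OF e0(1) w(1)] by (simp add: S_def)
      show "w \<noteq> 0\<^sub>v 4" using w(2) by auto
      fix z b assume z: "z \<in> S"
      have "(A *\<^sub>v z) \<bullet>c e0 = z \<bullet>c (B *\<^sub>v e0)" using AB z e0 by (simp add: adjoint_pair_def S_def)
      also have "\<dots> = 0" unfolding Be using z e0 by (simp add: S_def conjugate_smult_vec)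
      finally show "A *\<^sub>v z + b \<cdot>\<^sub>v z \<in> S" using z e0 car by (simp add: S_def lin)
    qed (auto simp: S_def)
    then obtain z b where z: "z \<in> carrier_vec 4" "z \<bullet>c e0 = 0" "z \<noteq> 0\<^sub>v 4" "A *\<^sub>v z = b \<cdot>\<^sub>v z"
      unfolding S_def by blast
    obtain d where d: "d \<noteq> 0" "(d \<cdot>\<^sub>v z) \<bullet>c (d \<cdot>\<^sub>v z) = 1" using exists_unit_multiple[OF z(1,3)] .
    define e1 where "e1 = d \<cdot>\<^sub>v z"
    have e1: "e1 \<in> carrier_vec 4" "e1 \<bullet>c e1 = 1" "e1 \<bullet>c e0 = 0"
      using z d e0 by (auto simp: e1_def)
    have Ae1: "A *\<^sub>v e1 = b \<cdot>\<^sub>v e1"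
      using z A by (simp add: e1_def mult_mat_vec[OF A] smult_smult_assoc mult.commute)
    obtain e3 where e3: "e3 \<in> carrier_vec 4" "e3 \<bullet>c e3 = 1"
        "\<And>v. v \<in> set [e0, e1, B *\<^sub>v e1] \<Longrightarrow> v \<bullet>c e3 = 0"
      using exists_unit_orthogonal[of "[e0, e1, B *\<^sub>v e1]" 4] e0 e1 car by auto
    show ?thesis
      by (rule flagI[OF e1, of e3 r 0]) (use e0 e1 e3 Ae1 in \<open>auto simp: Ae\<close>)
  next
    case False
    define W where "W = mat_of_cols 4 [e0, A *\<^sub>v e0, A *\<^sub>v (A *\<^sub>v e0), B *\<^sub>v (A *\<^sub>v e0)]"
    have W: "W \<in> carrier_mat 4 4" by (rule carrier_matI) (simp_all add: W_def)
    have "flag_form A B e0 = 0" unfolding e0_def by (simp add: flag_form_smult[OF A B v(1)] zero)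
    then have "det W = 0" by (simp add: flag_form_def W_def)
    then obtain \<phi> where \<phi>: "\<phi> \<in> carrier_vec 4" "\<phi> \<noteq> 0\<^sub>v 4" "transpose_mat W *\<^sub>v \<phi> = 0\<^sub>v 4"
      using det_zero_iff_left_kernel[OF W] by blast
    have orth: "col W j \<bullet> \<phi> = 0" if "j < 4" for j
    proof -
      have "(transpose_mat W *\<^sub>v \<phi>) $ j = col W j \<bullet> \<phi>" using that W by simp
      then show ?thesis using \<phi>(3) that by simp
    qed
    have "conjugate \<phi> \<in> carrier_vec 4" "conjugate \<phi> \<noteq> 0\<^sub>v 4" using \<phi> by auto
    then obtain d where d: "d \<noteq> 0" "(d \<cdot>\<^sub>v conjugate \<phi>) \<bullet>c (d \<cdot>\<^sub>v conjugate \<phi>) = 1"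
      by (rule exists_unit_multiple)
    define e3 where "e3 = d \<cdot>\<^sub>v conjugate \<phi>"
    have e3: "e3 \<in> carrier_vec 4" "e3 \<bullet>c e3 = 1" using \<phi> d by (auto simp: e3_def)
    have orth3: "z \<bullet>c e3 = 0" if "z \<in> carrier_vec 4" "z \<bullet> \<phi> = 0" for z
      using that \<phi> by (simp add: e3_def conjugate_smult_vec)
    have cols: "col W 0 = e0" "col W 1 = A *\<^sub>v e0" "col W 2 = A *\<^sub>v (A *\<^sub>v e0)" "col W 3 = B *\<^sub>v (A *\<^sub>v e0)"
      using e0 car by (simp_all add: W_def)
    have o3: "e0 \<bullet>c e3 = 0" "(A *\<^sub>v e0) \<bullet>c e3 = 0" "(A *\<^sub>v (A *\<^sub>v e0)) \<bullet>c e3 = 0" "(B *\<^sub>v (A *\<^sub>v e0)) \<bullet>c e3 = 0"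
    proof -
      have "e0 \<bullet> \<phi> = 0" "(A *\<^sub>v e0) \<bullet> \<phi> = 0" "(A *\<^sub>v (A *\<^sub>v e0)) \<bullet> \<phi> = 0"
        "(B *\<^sub>v (A *\<^sub>v e0)) \<bullet> \<phi> = 0"
        using orth[of 0] orth[of 1] orth[of 2] orth[of 3] unfolding cols by simp_all
      then show "e0 \<bullet>c e3 = 0" "(A *\<^sub>v e0) \<bullet>c e3 = 0" "(A *\<^sub>v (A *\<^sub>v e0)) \<bullet>c e3 = 0"
        "(B *\<^sub>v (A *\<^sub>v e0)) \<bullet>c e3 = 0"
        using e0(1) car by (auto intro!: orth3)
    qed
    obtain g where g: "g \<noteq> 0" "(g \<cdot>\<^sub>v x) \<bullet>c (g \<cdot>\<^sub>v x) = 1" using exists_unit_multiple[OF x(1) False] .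
    define e1 where "e1 = g \<cdot>\<^sub>v x"
    have e1: "e1 \<in> carrier_vec 4" "e1 \<bullet>c e1 = 1" "e1 \<bullet>c e0 = 0" using x g e0 by (auto simp: e1_def)
    define r where "r = (A *\<^sub>v e0) \<bullet>c e0"
    have e1': "e1 = g \<cdot>\<^sub>v (A *\<^sub>v e0 - r \<cdot>\<^sub>v e0)" by (simp add: e1_def x_def r_def)
    have apply1: "M *\<^sub>v e1 = g \<cdot>\<^sub>v (M *\<^sub>v (A *\<^sub>v e0) - r \<cdot>\<^sub>v (M *\<^sub>v e0))" if "M \<in> carrier_mat 4 4" for M
      unfolding e1' using that e0 car
      by (simp add: mult_mat_vec[OF that] mult_minus_distrib_mat_vec[OF that])
    have "e1 \<bullet>c e3 = 0" unfolding e1' using o3 e0 e3 car by (simp add: lin)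
    moreover have "(A *\<^sub>v e1) \<bullet>c e3 = 0"
      unfolding apply1[OF A] using o3 e0 e3 car by (simp add: lin)
    moreover have "(B *\<^sub>v e1) \<bullet>c e3 = 0"
      unfolding apply1[OF B] Be0 using o3 e0 e3 car by (simp add: lin)
    moreover have "A *\<^sub>v e0 = r \<cdot>\<^sub>v e0 + (1 / g) \<cdot>\<^sub>v e1"
      using Ae0 g(1) x(1) by (simp add: e1_def r_def smult_smult_assoc)
    ultimately show ?thesis using flagI[OF e1 e3] o3(1) by blast
  qed
qed

lemma tridiagonal_4:
  assumes A: "A \<in> carrier_mat 4 4"
  shows "\<exists>U\<in>unitary_mats 4. tridiagonal (U * A * mat_adjoint U)"
proof -
  let ?B = "mat_adjoint A"
  have B: "?B \<in> carrier_mat 4 4" using A by (rule mat_adjoint_carrier)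
  note adj = adjoint_pair_adjoint[OF A]
  obtain v y a where v: "v \<in> carrier_vec 4" "v \<noteq> 0\<^sub>v 4"
    and zero: "(?B + y \<cdot>\<^sub>m A) *\<^sub>v v = a \<cdot>\<^sub>v v \<and> flag_form A ?B v = 0 \<or>
      (A + y \<cdot>\<^sub>m ?B) *\<^sub>v v = a \<cdot>\<^sub>v v \<and> flag_form ?B A v = 0"
    using form_zero_on_pencil_eigenvector[OF A B] by blast
  have "\<exists>e0 e1 e2 e3. flag_basis A ?B e0 e1 e2 e3"
    using zero
  proof
    assume "(?B + y \<cdot>\<^sub>m A) *\<^sub>v v = a \<cdot>\<^sub>v v \<and> flag_form A ?B v = 0"
    then show ?thesis using flag_basis_if_form_zero[OF adj v] by blast
  next
    assume "(A + y \<cdot>\<^sub>m ?B) *\<^sub>v v = a \<cdot>\<^sub>v v \<and> flag_form ?B A v = 0"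
    then obtain e0 e1 e2 e3 where "flag_basis ?B A e0 e1 e2 e3"
      using flag_basis_if_form_zero[OF adjoint_pair_commute[OF adj] v] by blast
    then have "flag_basis A ?B e0 e1 e2 e3" by (rule flag_basis_commute)
    then show ?thesis by blast
  qed
  then show ?thesis using tridiagonal_if_flag_basis[OF A] by blast
qed

text \<open>
Start from an eigenvector \<open>e0\<close> of \<open>A\<close> and choose \<open>e2\<close> orthogonal to \<open>e0\<close> and \<open>A\<^sup>* e0\<close>;
the former removes one corner entry, because \<open>A e0\<close> is a multiple of \<open>e0\<close>, and the latter the other.
\<close>

lemma tridiagonal_3:
  assumes A: "A \<in> carrier_mat 3 3"
  shows "\<exists>U\<in>unitary_mats 3. tridiagonal (U * A * mat_adjoint U)"
proof -
  let ?B = "mat_adjoint A"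
  have B: "?B \<in> carrier_mat 3 3" using A by (rule mat_adjoint_carrier)
  define w :: "complex vec" where "w = unit_vec 3 0"
  have w: "w \<in> carrier_vec 3" "w \<noteq> 0\<^sub>v 3" by (simp_all add: w_def)
  then have "\<exists>v\<in>carrier_vec 3. v \<noteq> 0\<^sub>v 3 \<and> (\<exists>a. A *\<^sub>v v = a \<cdot>\<^sub>v v)"
    using A w by (intro eigenvector_in_invariant_set[OF A, of _ w]) (auto intro!: mult_mat_vec_carrier[where n=3])
  then obtain v a where v: "v \<in> carrier_vec 3" "v \<noteq> 0\<^sub>v 3" "A *\<^sub>v v = a \<cdot>\<^sub>v v" by blast
  obtain c where c: "c \<noteq> 0" "(c \<cdot>\<^sub>v v) \<bullet>c (c \<cdot>\<^sub>v v) = 1" using exists_unit_multiple[OF v(1,2)] .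
  define e0 where "e0 = c \<cdot>\<^sub>v v"
  have e0: "e0 \<in> carrier_vec 3" "e0 \<bullet>c e0 = 1" using v c by (auto simp: e0_def)
  have Ae0: "A *\<^sub>v e0 = a \<cdot>\<^sub>v e0"
    using v A by (simp add: e0_def mult_mat_vec[OF A] smult_smult_assoc mult.commute)
  have Be0: "?B *\<^sub>v e0 \<in> carrier_vec 3" using B e0(1) by (rule mult_mat_vec_carrier)
  obtain e2 where e2: "e2 \<in> carrier_vec 3" "e2 \<bullet>c e2 = 1" "\<And>v. v \<in> set [e0, ?B *\<^sub>v e0] \<Longrightarrow> v \<bullet>c e2 = 0"
    using exists_unit_orthogonal[of "[e0, ?B *\<^sub>v e0]" 3] e0 Be0 by auto
  obtain e1 where e1: "e1 \<in> carrier_vec 3" "e1 \<bullet>c e1 = 1" "\<And>v. v \<in> set [e0, e2] \<Longrightarrow> v \<bullet>c e1 = 0"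
    using exists_unit_orthogonal[of "[e0, e2]" 3] e0 e2 by auto
  have e12: "e1 \<bullet>c e2 = 0" using scalar_prod_conjugate_commute[OF e2(1) e1(1)] e1 by simp
  show ?thesis
  proof (rule tridiagonal_if_orthonormal[OF A])
    show "orthonormal 3 (\<lambda>i. [e0, e1, e2] ! i)"
    proof (rule orthonormalI)
      fix i j :: nat assume "i < j" "j < 3"
      then have "i = 0 \<and> j = 1 \<or> i = 0 \<and> j = 2 \<or> i = 1 \<and> j = 2" by auto
      then show "[e0, e1, e2] ! i \<bullet>c [e0, e1, e2] ! j = 0" using e1 e2 e12 by auto
    next
      fix i :: nat assume "i < 3"
      then have "i = 0 \<or> i = 1 \<or> i = 2" by auto
      then show "[e0, e1, e2] ! i \<in> carrier_vec 3" "[e0, e1, e2] ! i \<bullet>c [e0, e1, e2] ! i = 1"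
        using e0 e1 e2 by auto
    qed
    fix i j :: nat assume "i < 3" "j < 3" "2 \<le> \<bar>int i - int j\<bar>"
    then have "i = 2 \<and> j = 0 \<or> i = 0 \<and> j = 2" by auto
    moreover have "(A *\<^sub>v e0) \<bullet>c e2 = 0" unfolding Ae0 using e0 e2 by simp
    moreover have "(A *\<^sub>v e2) \<bullet>c e0 = 0"
      by (rule adjoint_pair_entry[OF adjoint_pair_adjoint[OF A] e2(1) e0(1)]) (use e2 in simp)
    ultimately show "(A *\<^sub>v [e0, e1, e2] ! j) \<bullet>c [e0, e1, e2] ! i = 0" by auto
  qed
qed

lemma tridiagonal_le_2:
  assumes A: "A \<in> carrier_mat n n" and n: "n \<le> 2"
  shows "\<exists>U\<in>unitary_mats n. tridiagonal (U * A * mat_adjoint U)"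
proof (rule tridiagonal_if_orthonormal[OF A])
  show "orthonormal n (unit_vec n)"
    by (rule orthonormalI) (auto simp: conjugate_vec_def)
qed (use n in auto)

theorem theorem1p1:
  fixes n :: nat and A :: "complex mat"
  assumes "1 \<le> n" and "n \<le> 4"
    and "A \<in> carrier_mat n n"
  shows "\<exists>U \<in> unitary_mats n. tridiagonal (U * A * mat_adjoint U)"
proof -
  consider "n \<le> 2" | "n = 3" | "n = 4" using assms(2) by linarith
  then show ?thesis
    using assms(3) tridiagonal_le_2 tridiagonal_3 tridiagonal_4 by cases auto
qed

end
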